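(* Let $\rho,\kappa,\delta>0$, $0<\alpha<1$ and let $v_0,v_1\in\mathcal S(\mathbb R)$ be real valued. Let $u$ be the solution, with initial data $u(0,\cdot)=v_0$, $u_t(0,\cdot)=v_1$, of the nonlocal wave equation described in the context. Then $u$ preserves the energy, the momentum and the angular momentum, i.e. each of the three quantities $$E[u(t,\cdot)]:=\frac\rho2\|u_t(t,\cdot)\|_{L^2(\mathbb R)}^2+\frac\kappa2\int_{\mathbb R}\int_{-\delta}^{\delta}\frac{|u(t,x)-u(t,x-y)|^2}{|y|^{1+2\alpha}}\,dy\,dx,$$ $$P[u(t,\cdot)]:=\rho\int_{\mathbb R}u_t(t,x)\,dx,\qquad L[u(t,\cdot)]:=\rho\int_{\mathbb R}x\,u_t(t,x)\,dx$$ is constant in time.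
   Context: The nonlocal wave equation is $\rho\,u_{tt}(t,x)=-2\kappa\int_{-\delta}^{\delta}\frac{u(t,x)-u(t,x-y)}{|y|^{1+2\alpha}}\,dy$ for $t>0$, $x\in\mathbb R$, the integral being understood in the principal value sense. Its solution with initial data $(v_0,v_1)$ is $$u(t,x)=\int_{\mathbb R}e^{-i\xi x}\left[\widehat{v_0}(\xi)\cos(\omega(\xi)t)+\frac{\widehat{v_1}(\xi)}{\omega(\xi)}\sin(\omega(\xi)t)\right]d\xi,\qquad \omega(\xi)=\left(\frac{2\kappa}{\rho\,\delta^{2\alpha}}\int_{-1}^{1}\frac{1-\cos(\xi\delta z)}{|z|^{1+2\alpha}}\,dz\right)^{1/2},$$ where $\widehat v(\xi):=\frac1{2\pi}\int_{\mathbb R}v(x)e^{ix\xi}\,dx$ and $\sin(\omega t)/\omega$ is understood as $t$ where $\omega=0$. *)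

theory Defs
  imports "HOL-Analysis.Analysis"
begin

definition schwartz :: "(real \<Rightarrow> real) \<Rightarrow> bool" where
  "schwartz v \<longleftrightarrow>
     (\<forall>n. (deriv ^^ n) v differentiable_on UNIV) \<and>
     (\<forall>k n. bounded (range (\<lambda>x. x ^ k * (deriv ^^ n) v x)))"

definition fourier :: "(real \<Rightarrow> real) \<Rightarrow> real \<Rightarrow> complex" where
  "fourier v \<xi> =
     1 / (2 * pi) * (\<integral>x. complex_of_real (v x) * exp (\<i> * x * \<xi>) \<partial>lborel)"

text \<open>The integrand below is absolutely integrable for \<open>\<alpha> < 1\<close>, so no principal value is
  needed; its value at \<open>z = 0\<close> is immaterial.\<close>

definition dispersion :: "real \<Rightarrow> real \<Rightarrow> real \<Rightarrow> real \<Rightarrow> real \<Rightarrow> real" where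
  "dispersion \<rho> \<kappa> \<delta> \<alpha> \<xi> =
     sqrt (2 * \<kappa> / (\<rho> * \<delta> powr (2 * \<alpha>)) *
       (LBINT z:{-1..1}. (1 - cos (\<xi> * \<delta> * z)) / \<bar>z\<bar> powr (1 + 2 * \<alpha>)))"

text \<open>Solution, at time \<open>t\<close> and position \<open>x\<close>, of the nonlocal wave equation
  \<open>\<rho> u\<^sub>t\<^sub>t(t,x) = -2\<kappa> p.v.\<integral>\<^bsub>-\<delta>\<^esub>\<^bsup>\<delta>\<^esup> (u(t,x) - u(t,x-y)) / \<bar>y\<bar>\<^bsup>1+2\<alpha>\<^esup> dy\<close>
  with \<open>u(0,x) = v0 x\<close> and \<open>u\<^sub>t(0,x) = v1 x\<close>, given by its Fourier representation.
  It is complex-valued as a formula; that its values are real for real data is not built in.\<close>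

definition nonlocal_wave ::
  "real \<Rightarrow> real \<Rightarrow> real \<Rightarrow> real \<Rightarrow> (real \<Rightarrow> real) \<Rightarrow> (real \<Rightarrow> real) \<Rightarrow> real \<Rightarrow> real \<Rightarrow> complex"
where
  "nonlocal_wave \<rho> \<kappa> \<delta> \<alpha> v0 v1 t x =
     (\<integral>\<xi>. exp (- \<i> * \<xi> * x) *
        (let \<omega> = dispersion \<rho> \<kappa> \<delta> \<alpha> \<xi> in
           fourier v0 \<xi> * cos (\<omega> * t) +
           fourier v1 \<xi> * (if \<omega> = 0 then t else sin (\<omega> * t) / \<omega>)) \<partial>lborel)"

definition time_deriv :: "(real \<Rightarrow> real \<Rightarrow> complex) \<Rightarrow> real \<Rightarrow> real \<Rightarrow> complex" where
  "time_deriv u t x = vector_derivative (\<lambda>s. u s x) (at t)"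

definition energy_density ::
  "real \<Rightarrow> (real \<Rightarrow> real \<Rightarrow> complex) \<Rightarrow> real \<Rightarrow> real \<Rightarrow> real \<Rightarrow> real" where
  "energy_density \<alpha> u t x y = (cmod (u t x - u t (x - y)))\<^sup>2 / \<bar>y\<bar> powr (1 + 2 * \<alpha>)"

definition energy ::
  "real \<Rightarrow> real \<Rightarrow> real \<Rightarrow> real \<Rightarrow> (real \<Rightarrow> real \<Rightarrow> complex) \<Rightarrow> real \<Rightarrow> real" where
  "energy \<rho> \<kappa> \<delta> \<alpha> u t =
     \<rho> / 2 * (\<integral>x. (cmod (time_deriv u t x))\<^sup>2 \<partial>lborel) +
     \<kappa> / 2 * (\<integral>x. (LBINT y:{-\<delta>..\<delta>}. energy_density \<alpha> u t x y) \<partial>lborel)"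

definition momentum :: "real \<Rightarrow> (real \<Rightarrow> real \<Rightarrow> complex) \<Rightarrow> real \<Rightarrow> complex" where
  "momentum \<rho> u t = \<rho> * (\<integral>x. time_deriv u t x \<partial>lborel)"

definition angular_momentum :: "real \<Rightarrow> (real \<Rightarrow> real \<Rightarrow> complex) \<Rightarrow> real \<Rightarrow> complex" where
  "angular_momentum \<rho> u t = \<rho> * (\<integral>x. x * time_deriv u t x \<partial>lborel)"

text \<open>Existence of the time derivative and absolute convergence of every integral in the three
  quantities at time \<open>t\<close>; otherwise \<open>vector_derivative\<close> and the Bochner integral
  would return default values.\<close>

definition quantities_well_defined ::
  "real \<Rightarrow> real \<Rightarrow> (real \<Rightarrow> real \<Rightarrow> complex) \<Rightarrow> real \<Rightarrow> bool" where
  "quantities_well_defined \<delta> \<alpha> u t \<longleftrightarrow>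
     (\<forall>x. (\<lambda>s. u s x) differentiable (at t)) \<and>
     integrable lborel (\<lambda>x. (cmod (time_deriv u t x))\<^sup>2) \<and>
     (\<forall>x. set_integrable lborel {-\<delta>..\<delta>} (energy_density \<alpha> u t x)) \<and>
     integrable lborel (\<lambda>x. LBINT y:{-\<delta>..\<delta>}. energy_density \<alpha> u t x y) \<and>
     integrable lborel (time_deriv u t) \<and>
     integrable lborel (\<lambda>x. x * time_deriv u t x)"

end

theory Submission
  imports
    Defs
    "HOL-Probability.Characteristic_Functions"
    "HOL-Probability.Sinc_Integral"
    "HOL-Complex_Analysis.Cauchy_Integral_Formula"
begin

text \<open>On the Fourier side the wave equation decouples: for each frequency \<open>\<xi>\<close> the amplitude solves the
harmonic oscillator \<open>f'' = - \<omega>(\<xi>)\<^sup>2 f\<close>. The solution is \<open>u(t) = FT (-1) (amplitude t)\<close> and its time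
derivative is \<open>FT (-1) (velocity t)\<close>, where \<open>velocity\<close> is the time derivative of \<open>amplitude\<close>.

\<^bold>\<open>Conservation.\<close> Fourier inversion turns \<open>\<integral> u\<^sub>t dx\<close> into \<open>2\<pi>\<close> times the velocity at frequency \<open>0\<close>
(\<open>integral_FT\<close>), and \<open>\<integral> x u\<^sub>t dx\<close> into a multiple of its \<open>\<xi>\<close>-derivative there (\<open>integral_ident_FT\<close>).
Since \<open>\<omega>\<^sup>2\<close> vanishes to second order at \<open>0\<close>, neither depends on time (\<open>velocity_0\<close>,
\<open>dv_velocity_0\<close>). The Plancherel identity turns the energy into
\<open>\<pi>\<rho> \<integral> |velocity|\<^sup>2 + \<omega>\<^sup>2 |amplitude|\<^sup>2 d\<xi>\<close>: in the interaction term the Fourier multiplier of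
\<open>u(x) - u(x - y)\<close> is \<open>1 - e\<^bsup>iy\<xi>\<^esup>\<close>, with squared modulus \<open>2(1 - cos(y\<xi>))\<close>, and integrating this
against the kernel gives \<open>\<omega>\<^sup>2\<close> up to a constant (\<open>nonlocal_energy_Fourier\<close>). The integrand is the
energy of one oscillator and is conserved for each \<open>\<xi>\<close> separately (\<open>energy_balance\<close>).

\<^bold>\<open>Convergence.\<close> All integrals converge absolutely because amplitude and velocity are Schwartz
functions of \<open>\<xi>\<close>, so that \<open>u\<close> and \<open>u\<^sub>t\<close> are Schwartz functions of \<open>x\<close>. This is the point that needs
care: \<open>\<omega>\<close> behaves like \<open>|\<xi>|\<close> near \<open>0\<close> and is not smooth. But \<open>\<omega>\<^sup>2\<close> is smooth with
derivatives of polynomial growth (\<open>tempered_dispersion_sq\<close>), and \<open>cos (\<omega>t)\<close>, \<open>sin (\<omega>t)/\<omega>\<close> and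
\<open>\<omega> sin (\<omega>t)\<close> depend only on \<open>\<omega>\<^sup>2\<close>: they are expressed by the entire function
\<open>z \<mapsto> cos (\<surd>z)\<close> and its derivative. All derivatives of that function are bounded on the positive half-line,
by Cauchy's estimates on unit discs (\<open>norm_higher_deriv_cos_sqrt_le\<close>). Hence the two propagators
are smooth multipliers with polynomially bounded derivatives (\<open>tempered_cos_sqrt_compose\<close>), and
these preserve the Schwartz space.\<close>

section \<open>Smooth functions with growth conditions\<close>

abbreviation dv :: "(real \<Rightarrow> complex) \<Rightarrow> real \<Rightarrow> complex" where
  "dv f \<equiv> (\<lambda>x. vector_derivative f (at x))"

text \<open>Recursion on the number of derivatives, rather than a condition on an explicit \<open>n\<close>-th derivative,
lets closure under products be proved by a short induction instead of the Leibniz formula. Taking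
for the class \<open>P\<close> polynomial boundedness or rapid decrease gives the smooth multipliers and the
Schwartz functions.\<close>

primrec derivs_in :: "((real \<Rightarrow> complex) \<Rightarrow> bool) \<Rightarrow> nat \<Rightarrow> (real \<Rightarrow> complex) \<Rightarrow> bool" where
  "derivs_in P 0 f \<longleftrightarrow> P f"
| "derivs_in P (Suc n) f \<longleftrightarrow> P f \<and> (\<forall>x. f differentiable (at x)) \<and> derivs_in P n (dv f)"

lemma derivs_inI:
  assumes "P f" "\<And>x. (f has_vector_derivative f' x) (at x)" "derivs_in P n f'"
  shows "derivs_in P (Suc n) f"
proof -
  have "dv f = f'"
    using assms(2) by (auto intro!: ext vector_derivative_at)
  then show ?thesis
    using assms by (auto intro: differentiableI_vector)
qed

lemma derivs_in_SucD: "derivs_in P (Suc n) f \<Longrightarrow> derivs_in P n f"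
  by (induction n arbitrary: f) auto

lemma derivs_in_vector_derivative:
  "derivs_in P (Suc n) f \<Longrightarrow> (f has_vector_derivative dv f x) (at x)"
  by (simp add: vector_derivative_works[symmetric])

text \<open>For functions given by a formula the whole tower of derivatives is usually known in closed form; then
only the class condition has to be verified.\<close>

lemma derivs_in_sequence:
  assumes "\<And>k. P (F k)" "\<And>k x. (F k has_vector_derivative F (Suc k) x) (at x)"
  shows "derivs_in P n (F k)"
proof (induction n arbitrary: k)
  case (Suc n)
  show ?case by (rule derivs_inI[where f' = "F (Suc k)"]) (use assms Suc in auto)
qed (use assms in auto)

lemma derivs_in_add:
  assumes P: "\<And>f g. P f \<Longrightarrow> P g \<Longrightarrow> P (\<lambda>x. f x + g x)"
  shows "derivs_in P n f \<Longrightarrow> derivs_in P n g \<Longrightarrow> derivs_in P n (\<lambda>x. f x + g x)"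
proof (induction n arbitrary: f g)
  case (Suc n)
  show ?case
    by (rule derivs_inI[where f' = "\<lambda>x. dv f x + dv g x"])
       (use Suc P in \<open>auto intro!: has_vector_derivative_add derivs_in_vector_derivative\<close>)
qed (use P in auto)

lemma derivs_in_mult:
  assumes PQ: "\<And>f g. P f \<Longrightarrow> Q g \<Longrightarrow> R (\<lambda>x. f x * g x)"
    and R: "\<And>f g. R f \<Longrightarrow> R g \<Longrightarrow> R (\<lambda>x. f x + g x)"
  shows "derivs_in P n f \<Longrightarrow> derivs_in Q n g \<Longrightarrow> derivs_in R n (\<lambda>x. f x * g x)"
proof (induction n arbitrary: f g)
  case (Suc n)
  have "derivs_in R n (\<lambda>x. f x * dv g x + dv f x * g x)"
    using Suc.prems derivs_in_SucD[OF Suc.prems(1)] derivs_in_SucD[OF Suc.prems(2)]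
    by (intro derivs_in_add R Suc.IH) auto
  then show ?case
    by (intro derivs_inI[where f' = "\<lambda>x. f x * dv g x + dv f x * g x"] PQ
          has_vector_derivative_mult derivs_in_vector_derivative[OF Suc.prems(1)]
          derivs_in_vector_derivative[OF Suc.prems(2)])
       (use Suc.prems in auto)
qed (use PQ in auto)

text \<open>The weight \<open>1 + |x|\<close> is used instead of \<open>|x|\<close> because its powers are increasing in the exponent, so
that bounds of different order can be compared.\<close>

definition poly_bounded :: "(real \<Rightarrow> complex) \<Rightarrow> bool" where
  "poly_bounded f \<longleftrightarrow> (\<exists>k B. \<forall>x. cmod (f x) \<le> B * (1 + \<bar>x\<bar>) ^ k)"

definition rapidly_decreasing :: "(real \<Rightarrow> complex) \<Rightarrow> bool" where
  "rapidly_decreasing f \<longleftrightarrow> (\<forall>k. \<exists>B. \<forall>x. (1 + \<bar>x\<bar>) ^ k * cmod (f x) \<le> B)"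

definition tempered :: "(real \<Rightarrow> complex) \<Rightarrow> bool" where
  "tempered f \<longleftrightarrow> (\<forall>n. derivs_in poly_bounded n f)"

text \<open>The complex-valued counterpart of \<^const>\<open>schwartz\<close>; the two are related by
\<open>Schwartz_of_schwartz\<close> below.\<close>

definition Schwartz :: "(real \<Rightarrow> complex) \<Rightarrow> bool" where
  "Schwartz f \<longleftrightarrow> (\<forall>n. derivs_in rapidly_decreasing n f)"

lemma poly_boundedD:
  assumes "poly_bounded f"
  shows "\<exists>B k. B \<ge> 0 \<and> (\<forall>x. cmod (f x) \<le> B * (1 + \<bar>x\<bar>) ^ k)"
proof -
  from assms obtain k B where *: "\<And>x. cmod (f x) \<le> B * (1 + \<bar>x\<bar>) ^ k"
    by (auto simp: poly_bounded_def)
  have "0 \<le> cmod (f 0)" by simp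
  also have "\<dots> \<le> B" using *[of 0] by simp
  finally show ?thesis using * by blast
qed

lemma poly_bounded_add:
  assumes "poly_bounded f" "poly_bounded g"
  shows "poly_bounded (\<lambda>x. f x + g x)"
proof -
  obtain B k where f: "B \<ge> 0" "\<And>x. cmod (f x) \<le> B * (1 + \<bar>x\<bar>) ^ k"
    using poly_boundedD[OF assms(1)] by blast
  obtain C l where g: "C \<ge> 0" "\<And>x. cmod (g x) \<le> C * (1 + \<bar>x\<bar>) ^ l"
    using poly_boundedD[OF assms(2)] by blast
  have "cmod (f x + g x) \<le> (B + C) * (1 + \<bar>x\<bar>) ^ (k + l)" for x
  proof -
    have "(1 + \<bar>x\<bar>) ^ k \<le> (1 + \<bar>x\<bar>) ^ (k + l)" "(1 + \<bar>x\<bar>) ^ l \<le> (1 + \<bar>x\<bar>) ^ (k + l)"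
      by (rule power_increasing; simp)+
    then have "B * (1 + \<bar>x\<bar>) ^ k + C * (1 + \<bar>x\<bar>) ^ l
        \<le> B * (1 + \<bar>x\<bar>) ^ (k + l) + C * (1 + \<bar>x\<bar>) ^ (k + l)"
      using f(1) g(1) by (intro add_mono mult_left_mono) auto
    then show ?thesis
      using norm_triangle_ineq[of "f x" "g x"] f(2)[of x] g(2)[of x] by (simp add: algebra_simps)
  qed
  then show ?thesis unfolding poly_bounded_def by blast
qed

lemma poly_bounded_mult:
  assumes "poly_bounded f" "poly_bounded g"
  shows "poly_bounded (\<lambda>x. f x * g x)"
proof -
  obtain B k where f: "B \<ge> 0" "\<And>x. cmod (f x) \<le> B * (1 + \<bar>x\<bar>) ^ k"
    using poly_boundedD[OF assms(1)] by blast
  obtain C l where g: "C \<ge> 0" "\<And>x. cmod (g x) \<le> C * (1 + \<bar>x\<bar>) ^ l"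
    using poly_boundedD[OF assms(2)] by blast
  have "cmod (f x * g x) \<le> (B * C) * (1 + \<bar>x\<bar>) ^ (k + l)" for x
    using mult_mono[OF f(2)[of x] g(2)[of x]] f(1) g(1)
    by (simp add: norm_mult power_add algebra_simps)
  then show ?thesis unfolding poly_bounded_def by blast
qed

lemma rapidly_decreasing_add:
  assumes "rapidly_decreasing f" "rapidly_decreasing g"
  shows "rapidly_decreasing (\<lambda>x. f x + g x)"
  unfolding rapidly_decreasing_def
proof
  fix k
  obtain B C where "\<And>x. (1 + \<bar>x\<bar>) ^ k * cmod (f x) \<le> B" "\<And>x. (1 + \<bar>x\<bar>) ^ k * cmod (g x) \<le> C"
    using assms unfolding rapidly_decreasing_def by metis
  then have "(1 + \<bar>x\<bar>) ^ k * cmod (f x + g x) \<le> B + C" for x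
    using mult_left_mono[OF norm_triangle_ineq[of "f x" "g x"], of "(1 + \<bar>x\<bar>) ^ k"]
    by (smt (verit) distrib_left zero_le_power abs_ge_zero)
  then show "\<exists>B. \<forall>x. (1 + \<bar>x\<bar>) ^ k * cmod (f x + g x) \<le> B" by blast
qed

lemma rapidly_decreasing_mult:
  assumes "poly_bounded f" "rapidly_decreasing g"
  shows "rapidly_decreasing (\<lambda>x. f x * g x)"
  unfolding rapidly_decreasing_def
proof
  fix k
  obtain B l where f: "B \<ge> 0" "\<And>x. cmod (f x) \<le> B * (1 + \<bar>x\<bar>) ^ l"
    using poly_boundedD[OF assms(1)] by blast
  obtain C where g: "\<And>x. (1 + \<bar>x\<bar>) ^ (k + l) * cmod (g x) \<le> C"
    using assms unfolding rapidly_decreasing_def by metis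
  have "(1 + \<bar>x\<bar>) ^ k * cmod (f x * g x) \<le> B * C" for x
  proof -
    have "(1 + \<bar>x\<bar>) ^ k * cmod (f x * g x)
        \<le> (1 + \<bar>x\<bar>) ^ k * ((B * (1 + \<bar>x\<bar>) ^ l) * cmod (g x))"
      unfolding norm_mult by (intro mult_left_mono mult_right_mono f) auto
    also have "\<dots> = B * ((1 + \<bar>x\<bar>) ^ (k + l) * cmod (g x))"
      by (simp add: power_add algebra_simps)
    also have "\<dots> \<le> B * C" by (intro mult_left_mono f g)
    finally show ?thesis .
  qed
  then show "\<exists>B. \<forall>x. (1 + \<bar>x\<bar>) ^ k * cmod (f x * g x) \<le> B" by blast
qed

lemma tempered_add: "tempered f \<Longrightarrow> tempered g \<Longrightarrow> tempered (\<lambda>x. f x + g x)"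
  unfolding tempered_def by (blast intro: derivs_in_add poly_bounded_add)

lemma tempered_mult: "tempered f \<Longrightarrow> tempered g \<Longrightarrow> tempered (\<lambda>x. f x * g x)"
  unfolding tempered_def by (blast intro: derivs_in_mult poly_bounded_mult poly_bounded_add)

lemma Schwartz_add: "Schwartz f \<Longrightarrow> Schwartz g \<Longrightarrow> Schwartz (\<lambda>x. f x + g x)"
  unfolding Schwartz_def by (blast intro: derivs_in_add rapidly_decreasing_add)

lemma Schwartz_mult: "tempered f \<Longrightarrow> Schwartz g \<Longrightarrow> Schwartz (\<lambda>x. f x * g x)"
  unfolding tempered_def Schwartz_def
  by (blast intro: derivs_in_mult rapidly_decreasing_mult rapidly_decreasing_add)

lemma bounded_imp_poly_bounded:
  assumes "\<And>x. cmod (f x) \<le> B" shows "poly_bounded f"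
  unfolding poly_bounded_def using assms by (intro exI[of _ 0] exI[of _ B]) auto

lemma tempered_const: "tempered (\<lambda>x. c)"
proof -
  have "derivs_in poly_bounded n (\<lambda>x. c)" for n
  proof (induction n arbitrary: c)
    case (Suc n)
    show ?case
      by (rule derivs_inI[where f' = "\<lambda>x. 0"]) (use Suc in \<open>auto intro: bounded_imp_poly_bounded\<close>)
  qed (auto intro: bounded_imp_poly_bounded)
  then show ?thesis by (simp add: tempered_def)
qed

lemma tempered_of_real: "tempered (\<lambda>x. of_real x)"
proof -
  have p: "poly_bounded (\<lambda>x. of_real x)"
    unfolding poly_bounded_def by (intro exI[of _ 1] exI[of _ 1]) auto
  have "derivs_in poly_bounded n (\<lambda>x. of_real x)" for n
  proof (cases n)
    case (Suc m)
    have "derivs_in poly_bounded m (\<lambda>x. 1)"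
      using tempered_const[of 1] by (simp add: tempered_def)
    then show ?thesis unfolding Suc
      by (intro derivs_inI[where f' = "\<lambda>x. 1"] p)
         (auto intro!: derivative_eq_intros has_vector_derivative_real_field DERIV_ident)
  qed (use p in auto)
  then show ?thesis by (simp add: tempered_def)
qed

lemma Schwartz_dv: "Schwartz f \<Longrightarrow> Schwartz (dv f)"
  unfolding Schwartz_def by (metis derivs_in.simps(2))

lemma Schwartz_has_dv: "Schwartz f \<Longrightarrow> (f has_vector_derivative dv f x) (at x)"
  unfolding Schwartz_def using derivs_in_vector_derivative by blast

lemma Schwartz_rapidly_decreasing: "Schwartz f \<Longrightarrow> rapidly_decreasing f"
  unfolding Schwartz_def by (metis derivs_in.simps(1))

lemma Schwartz_continuous: "Schwartz f \<Longrightarrow> continuous_on A f"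
  by (intro continuous_at_imp_continuous_on ballI)
     (rule has_vector_derivative_continuous[OF Schwartz_has_dv])

lemma Schwartz_measurable [measurable_dest]: "Schwartz f \<Longrightarrow> f \<in> borel_measurable borel"
  by (rule borel_measurable_continuous_onI[OF Schwartz_continuous])

lemma Schwartz_bounded:
  assumes "Schwartz f" obtains B where "B \<ge> 0" "\<And>x. cmod (f x) \<le> B"
proof -
  obtain B where B: "\<And>x. (1 + \<bar>x\<bar>) ^ 0 * cmod (f x) \<le> B"
    using Schwartz_rapidly_decreasing[OF assms] unfolding rapidly_decreasing_def by metis
  have "0 \<le> cmod (f 0)" by simp
  also have "cmod (f 0) \<le> B" using B[of 0] by simp
  finally show ?thesis using B that by simp
qed

lemma integrable_inverse_one_plus_square: "integrable lborel (\<lambda>x::real. inverse (1 + x\<^sup>2))"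
  using Sinc_Integral.integrable_inverse_1_plus_square by (simp add: set_integrable_def)

lemma Schwartz_integrable:
  assumes "Schwartz f" shows "integrable lborel f"
proof -
  obtain B where B: "\<And>x. (1 + \<bar>x\<bar>) ^ 2 * cmod (f x) \<le> B"
    using Schwartz_rapidly_decreasing[OF assms] unfolding rapidly_decreasing_def by metis
  have bound: "cmod (f x) \<le> norm (B * inverse (1 + x\<^sup>2))" for x
  proof -
    have "0 \<le> (1 + \<bar>x\<bar>) ^ 2 * cmod (f x)" by simp
    then have "0 \<le> B" using B[of x] by linarith
    have "(1 + x\<^sup>2) * cmod (f x) \<le> (1 + \<bar>x\<bar>) ^ 2 * cmod (f x)"
      by (intro mult_right_mono) (auto simp: power2_eq_square algebra_simps)
    then have "(1 + x\<^sup>2) * cmod (f x) \<le> B" using B[of x] by linarith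
    moreover have "0 < 1 + x\<^sup>2" by (rule add_pos_nonneg) auto
    ultimately have "cmod (f x) \<le> B / (1 + x\<^sup>2)" by (simp add: field_simps)
    then show ?thesis using \<open>0 \<le> B\<close> by (simp add: divide_inverse)
  qed
  show ?thesis
    by (rule Bochner_Integration.integrable_bound[OF integrable_mult_right[OF integrable_inverse_one_plus_square, of B]])
       (use bound Schwartz_measurable[OF assms] in auto)
qed

lemma Schwartz_cmult: "Schwartz f \<Longrightarrow> Schwartz (\<lambda>x. c * f x)"
  by (rule Schwartz_mult[OF tempered_const])

lemma Schwartz_ident_mult: "Schwartz f \<Longrightarrow> Schwartz (\<lambda>x. of_real x * f x)"
  by (rule Schwartz_mult[OF tempered_of_real])


text \<open>One factor \<open>f\<close> is bounded, and the other one absorbs the growth of the weight \<open>w\<close>.\<close>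

lemma Schwartz_cmod_square_integrable:
  assumes "tempered w" "Schwartz f" shows "integrable lborel (\<lambda>x. cmod (w x) * (cmod (f x))\<^sup>2)"
proof -
  obtain B where B: "B \<ge> 0" "\<And>x. cmod (f x) \<le> B" using Schwartz_bounded[OF assms(2)] by blast
  have wf: "Schwartz (\<lambda>x. w x * f x)" using assms by (rule Schwartz_mult)
  have m: "(\<lambda>x. cmod (w x * f x) * cmod (f x)) \<in> borel_measurable borel"
    using Schwartz_measurable[OF wf] Schwartz_measurable[OF assms(2)] by measurable
  have eq: "cmod (w x) * (cmod (f x))\<^sup>2 = cmod (w x * f x) * cmod (f x)" for x
    by (simp add: norm_mult power2_eq_square)
  show ?thesis unfolding eq
  proof (rule Bochner_Integration.integrable_bound)
    show "integrable lborel (\<lambda>x. B * cmod (w x * f x))"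
      by (intro integrable_mult_right integrable_norm Schwartz_integrable wf)
    show "AE x in lborel. norm (cmod (w x * f x) * cmod (f x)) \<le> norm (B * cmod (w x * f x))"
    proof (rule AE_I2)
      fix x
      have "cmod (w x * f x) * cmod (f x) \<le> cmod (w x * f x) * B"
        by (intro mult_left_mono B) auto
      then show "norm (cmod (w x * f x) * cmod (f x)) \<le> norm (B * cmod (w x * f x))"
        using B(1) by (simp add: mult.commute)
    qed
  qed (use m in auto)
qed

section \<open>The Fourier transform on Schwartz functions\<close>

text \<open>All differentiations under the integral sign below have integrands with an explicit second-order
Taylor estimate, uniform in the increment. Such an estimate integrates directly, which avoids any limit
theorem.\<close>

lemma has_vector_derivative_quadratic_remainder:
  fixes F :: "real \<Rightarrow> complex"
  assumes "\<And>h. cmod (F (x + h) - F x - h *\<^sub>R F') \<le> B * h\<^sup>2"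
  shows "(F has_vector_derivative F') (at x)"
  unfolding has_vector_derivative_def has_derivative_at
proof
  show "(\<lambda>h. norm (F (x + h) - F x - h *\<^sub>R F') / norm h) \<midarrow>0\<rightarrow> 0"
  proof (rule Lim_null_comparison)
    show "\<forall>\<^sub>F h in at 0. norm (norm (F (x + h) - F x - h *\<^sub>R F') / norm h) \<le> B * \<bar>h\<bar>"
      unfolding eventually_at_filter
    proof (rule always_eventually, intro allI impI)
      fix h :: real assume "h \<noteq> 0"
      then show "norm (norm (F (x + h) - F x - h *\<^sub>R F') / norm h) \<le> B * \<bar>h\<bar>"
        using assms[of h] by (simp add: divide_le_eq power2_eq_square mult.assoc)
    qed
    show "(\<lambda>h. B * \<bar>h\<bar>) \<midarrow>0\<rightarrow> 0"
      by (rule tendsto_eq_intros refl | simp)+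
  qed
qed (auto intro: bounded_linear_scaleR_left)

lemma has_vector_derivative_integral_quadratic:
  fixes f :: "real \<Rightarrow> real \<Rightarrow> complex"
  assumes f: "\<And>x. integrable M (f x)" and f': "integrable M f'" and B: "integrable M B"
    and rem: "\<And>h y. cmod (f (x + h) y - f x y - h *\<^sub>R f' y) \<le> h\<^sup>2 * B y"
  shows "((\<lambda>x. \<integral>y. f x y \<partial>M) has_vector_derivative (\<integral>y. f' y \<partial>M)) (at x)"
proof (rule has_vector_derivative_quadratic_remainder)
  fix h
  have "(\<integral>y. f (x + h) y \<partial>M) - (\<integral>y. f x y \<partial>M) - h *\<^sub>R (\<integral>y. f' y \<partial>M)
      = (\<integral>y. f (x + h) y - f x y - h *\<^sub>R f' y \<partial>M)"
    using f f' by simp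
  also have "cmod \<dots> \<le> (\<integral>y. h\<^sup>2 * B y \<partial>M)"
    by (rule Bochner_Integration.integral_norm_bound_integral) (use f f' B rem in auto)
  finally show "cmod ((\<integral>y. f (x + h) y \<partial>M) - (\<integral>y. f x y \<partial>M) - h *\<^sub>R (\<integral>y. f' y \<partial>M))
      \<le> (\<integral>y. B y \<partial>M) * h\<^sup>2"
    by (simp add: mult.commute)
qed

lemma iexp_remainder: "cmod (iexp (\<theta> + h) - iexp \<theta> - h *\<^sub>R (\<i> * iexp \<theta>)) \<le> h\<^sup>2"
proof -
  have "iexp (\<theta> + h) - iexp \<theta> - h *\<^sub>R (\<i> * iexp \<theta>) = iexp \<theta> * (iexp h - (1 + \<i> * h))"
    by (simp add: exp_add algebra_simps scaleR_conv_of_real)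
  then have "cmod (iexp (\<theta> + h) - iexp \<theta> - h *\<^sub>R (\<i> * iexp \<theta>)) = cmod (iexp h - (1 + \<i> * h))"
    by (simp add: norm_mult)
  also have "\<dots> \<le> h\<^sup>2 / 2"
    using iexp_approx1[of h 1] by (simp add: power2_eq_square)
  also have "\<dots> \<le> h\<^sup>2" by simp
  finally show ?thesis .
qed

lemma cos_remainder: "\<bar>cos (\<theta> + h) - cos \<theta> + h * sin \<theta>\<bar> \<le> (h::real)\<^sup>2"
  using order_trans[OF abs_Re_le_cmod iexp_remainder[of \<theta> h]] by (simp add: Re_exp Im_exp)

lemma sin_remainder: "\<bar>sin (\<theta> + h) - sin \<theta> - h * cos \<theta>\<bar> \<le> (h::real)\<^sup>2"
  using order_trans[OF abs_Im_le_cmod iexp_remainder[of \<theta> h]] by (simp add: Re_exp Im_exp)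

lemma tempered_iexp: "tempered (\<lambda>x. iexp (c * x))"
proof -
  define F where "F k x = (\<i> * c) ^ k * iexp (c * x)" for k and x :: real
  have "derivs_in poly_bounded n (F 0)" for n
  proof (rule derivs_in_sequence)
    show "poly_bounded (F k)" for k
      by (rule bounded_imp_poly_bounded[of _ "\<bar>c\<bar> ^ k"]) (simp add: F_def norm_mult norm_power)
    have "((\<lambda>x. iexp (c * x)) has_vector_derivative \<i> * c * iexp (c * x)) (at x)" for x :: real
      by (auto intro!: derivative_eq_intros has_vector_derivative_real_field simp: algebra_simps)
    from has_vector_derivative_mult_right[OF this]
    show "(F k has_vector_derivative F (Suc k) x) (at x)" for k x
      unfolding F_def [abs_def] power_Suc2 mult.assoc .
  qed
  then show ?thesis by (simp add: tempered_def F_def [abs_def])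
qed

text \<open>The sign \<open>s = -1\<close> is the transform that represents the solution and \<open>s = 1\<close> is, up to the factor
\<open>1/(2\<pi>)\<close>, the one applied to the data. Keeping \<open>s\<close> as a parameter treats both at once.\<close>

definition FT :: "real \<Rightarrow> (real \<Rightarrow> complex) \<Rightarrow> real \<Rightarrow> complex" where
  "FT s f x = (\<integral>\<xi>. iexp (s * x * \<xi>) * f \<xi> \<partial>lborel)"

lemma integrable_iexp_mult:
  assumes "integrable lborel f" shows "integrable lborel (\<lambda>\<xi>. iexp (c * \<xi>) * f \<xi>)"
  by (rule Bochner_Integration.integrable_bound[OF assms])
     (use borel_measurable_integrable[OF assms] in \<open>auto simp: norm_mult intro!: borel_measurable_times borel_measurable_continuous_onI continuous_intros\<close>)

lemma FT_has_vector_derivative: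
  assumes f: "Schwartz f"
  shows "(FT s f has_vector_derivative FT s (\<lambda>\<xi>. \<i> * s * (of_real \<xi> * f \<xi>)) x) (at x)"
  unfolding FT_def [abs_def]
proof (rule has_vector_derivative_integral_quadratic)
  have xf: "Schwartz (\<lambda>\<xi>. of_real \<xi> * f \<xi>)" and xxf: "Schwartz (\<lambda>\<xi>. of_real \<xi> * (of_real \<xi> * f \<xi>))"
    by (intro Schwartz_ident_mult f)+
  show "integrable lborel (\<lambda>\<xi>. iexp (s * x * \<xi>) * f \<xi>)" for x
    by (intro integrable_iexp_mult Schwartz_integrable f)
  show "integrable lborel (\<lambda>\<xi>. iexp (s * x * \<xi>) * (\<i> * s * (of_real \<xi> * f \<xi>)))"
    by (intro integrable_iexp_mult Schwartz_integrable Schwartz_cmult xf)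
  show "integrable lborel (\<lambda>\<xi>. s\<^sup>2 * cmod (of_real \<xi> * (of_real \<xi> * f \<xi>)))"
    by (intro integrable_mult_right integrable_norm Schwartz_integrable xxf)
  fix h \<xi> :: real
  define \<theta> k where "\<theta> = s * x * \<xi>" and "k = s * h * \<xi>"
  have "iexp (s * (x + h) * \<xi>) * f \<xi> - iexp (s * x * \<xi>) * f \<xi>
      - h *\<^sub>R (iexp (s * x * \<xi>) * (\<i> * s * (of_real \<xi> * f \<xi>)))
      = (iexp (\<theta> + k) - iexp \<theta> - k *\<^sub>R (\<i> * iexp \<theta>)) * f \<xi>"
    by (simp add: \<theta>_def k_def algebra_simps scaleR_conv_of_real)
  also have "cmod \<dots> \<le> k\<^sup>2 * cmod (f \<xi>)"
    unfolding norm_mult by (intro mult_right_mono iexp_remainder) auto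
  also have "\<dots> = h\<^sup>2 * (s\<^sup>2 * cmod (of_real \<xi> * (of_real \<xi> * f \<xi>)))"
    by (simp add: k_def norm_mult power2_eq_square flip: abs_mult)
  finally show "cmod (iexp (s * (x + h) * \<xi>) * f \<xi> - iexp (s * x * \<xi>) * f \<xi>
      - h *\<^sub>R (iexp (s * x * \<xi>) * (\<i> * s * (of_real \<xi> * f \<xi>)))) \<le> h\<^sup>2 * (s\<^sup>2 * cmod (of_real \<xi> * (of_real \<xi> * f \<xi>)))" .
qed

lemma Schwartz_vanishes_at_infinity:
  assumes "Schwartz f" shows "(f \<longlongrightarrow> 0) at_infinity"
proof -
  obtain B where B: "\<And>x. (1 + \<bar>x\<bar>) ^ 1 * cmod (f x) \<le> B"
    using Schwartz_rapidly_decreasing[OF assms] unfolding rapidly_decreasing_def by metis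
  have "norm (f x) \<le> B * inverse (norm x)" if "x \<noteq> 0" for x
  proof -
    have "\<bar>x\<bar> * cmod (f x) \<le> (1 + \<bar>x\<bar>) ^ 1 * cmod (f x)" by (intro mult_right_mono) auto
    also have "\<dots> \<le> B" by (rule B)
    finally show ?thesis using that by (simp add: field_simps)
  qed
  then have "\<forall>\<^sub>F x in at_infinity. norm (f x) \<le> B * inverse (norm x)"
    using eventually_not_equal_at_infinity[of "0::real"] by (rule eventually_mono[rotated])
  moreover have "((\<lambda>x::real. B * inverse (norm x)) \<longlongrightarrow> B * 0) at_infinity"
    by (intro tendsto_mult tendsto_const tendsto_inverse_0_at_top filterlim_norm_at_top)
  ultimately show ?thesis
    using Lim_null_comparison[of f "\<lambda>x. B * inverse (norm x)"] by simp
qed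

lemma Schwartz_integral_dv_eq_0:
  assumes "Schwartz f" shows "(\<integral>x. dv f x \<partial>lborel) = 0"
proof -
  have "(LBINT x=-\<infinity>..\<infinity>. dv f x) = 0 - 0"
  proof (rule interval_integral_FTC_integrable)
    show "(f has_vector_derivative dv f x) (at x)" for x by (rule Schwartz_has_dv[OF assms])
    show "isCont (dv f) x" for x
      using Schwartz_continuous[OF Schwartz_dv[OF assms], of UNIV]
      by (simp add: continuous_on_eq_continuous_at)
    show "set_integrable lborel (einterval (-\<infinity>) \<infinity>) (dv f)"
      using Schwartz_integrable[OF Schwartz_dv[OF assms]] by (simp add: set_integrable_def)
    show "((f \<circ> real_of_ereal) \<longlongrightarrow> 0) (at_right (-\<infinity>))"
      unfolding ereal_tendsto_simps
      by (rule tendsto_mono[OF at_bot_le_at_infinity Schwartz_vanishes_at_infinity[OF assms]])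
    show "((f \<circ> real_of_ereal) \<longlongrightarrow> 0) (at_left \<infinity>)"
      unfolding ereal_tendsto_simps
      by (rule tendsto_mono[OF at_top_le_at_infinity Schwartz_vanishes_at_infinity[OF assms]])
  qed auto
  then show ?thesis
    by (simp add: interval_lebesgue_integral_def set_lebesgue_integral_def)
qed

text \<open>Integration by parts: the derivative of the Schwartz function \<open>e\<^bsup>isx\<xi>\<^esup> f(\<xi>)\<close> has integral \<open>0\<close>.\<close>

lemma FT_dv:
  assumes f: "Schwartz f"
  shows "FT s (dv f) x = - (\<i> * s * x) * FT s f x"
proof -
  define e where "e \<xi> = iexp (s * x * \<xi>)" for \<xi> :: real
  have e: "Schwartz g \<Longrightarrow> Schwartz (\<lambda>\<xi>. e \<xi> * g \<xi>)" for g
    unfolding e_def by (rule Schwartz_mult[OF tempered_iexp])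
  have e': "(e has_vector_derivative \<i> * s * x * e \<xi>) (at \<xi>)" for \<xi>
    unfolding e_def by (auto intro!: derivative_eq_intros has_vector_derivative_real_field simp: algebra_simps)
  have "dv (\<lambda>\<xi>. e \<xi> * f \<xi>) = (\<lambda>\<xi>. e \<xi> * dv f \<xi> + \<i> * s * x * (e \<xi> * f \<xi>))"
    by (rule ext, rule vector_derivative_at)
       (use has_vector_derivative_mult[OF e' Schwartz_has_dv[OF f]] in \<open>simp add: mult_ac\<close>)
  then have "0 = (\<integral>\<xi>. e \<xi> * dv f \<xi> + \<i> * s * x * (e \<xi> * f \<xi>) \<partial>lborel)"
    using Schwartz_integral_dv_eq_0[OF e[OF f]] by simp
  also have "\<dots> = FT s (dv f) x + \<i> * s * x * FT s f x"
    using Schwartz_integrable[OF e[OF f]] Schwartz_integrable[OF e[OF Schwartz_dv[OF f]]]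
    by (simp add: FT_def e_def)
  finally have "FT s (dv f) x + \<i> * s * x * FT s f x = 0" ..
  then show ?thesis by (simp add: eq_neg_iff_add_eq_0)
qed

text \<open>Each factor \<open>|x|\<close> is traded for one derivative of \<open>f\<close>, at the cost of \<open>1/|s|\<close>.\<close>

lemma FT_rapidly_decreasing:
  assumes s: "s \<noteq> 0" and f: "Schwartz f"
  shows "rapidly_decreasing (FT s f)"
  unfolding rapidly_decreasing_def
proof
  show "\<exists>B. \<forall>x. (1 + \<bar>x\<bar>) ^ k * cmod (FT s f x) \<le> B" for k
    using f
  proof (induction k arbitrary: f)
    case 0
    have "cmod (FT s f x) \<le> (\<integral>\<xi>. cmod (f \<xi>) \<partial>lborel)" for x
      unfolding FT_def by (rule order_trans[OF integral_norm_bound]) (simp add: norm_mult)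
    then show ?case by auto
  next
    case (Suc k)
    obtain B where B: "\<And>x. (1 + \<bar>x\<bar>) ^ k * cmod (FT s f x) \<le> B" using Suc by blast
    obtain C where C: "\<And>x. (1 + \<bar>x\<bar>) ^ k * cmod (FT s (dv f) x) \<le> C"
      using Suc.IH[OF Schwartz_dv[OF Suc.prems]] by blast
    have "(1 + \<bar>x\<bar>) ^ Suc k * cmod (FT s f x) \<le> B + C / \<bar>s\<bar>" for x
    proof -
      have "\<bar>x\<bar> * cmod (FT s f x) = cmod (FT s (dv f) x) / \<bar>s\<bar>"
        using s by (simp add: FT_dv[OF Suc.prems] norm_mult)
      then have "(1 + \<bar>x\<bar>) ^ Suc k * cmod (FT s f x)
          = (1 + \<bar>x\<bar>) ^ k * cmod (FT s f x) + (1 + \<bar>x\<bar>) ^ k * cmod (FT s (dv f) x) / \<bar>s\<bar>"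
        by (simp add: distrib_right distrib_left mult.assoc mult.left_commute flip: times_divide_eq_right)
      then show ?thesis
        using B[of x] divide_right_mono[OF C[of x], of "\<bar>s\<bar>"] by linarith
    qed
    then show ?case by blast
  qed
qed

text \<open>The derivative of a transform is again the transform of a Schwartz function, so decay for all
Schwartz functions already gives decay of all derivatives.\<close>

lemma Schwartz_FT:
  assumes s: "s \<noteq> 0" and f: "Schwartz f" shows "Schwartz (FT s f)"
  unfolding Schwartz_def
proof
  show "derivs_in rapidly_decreasing n (FT s f)" for n
    using f
  proof (induction n arbitrary: f)
    case 0 then show ?case using FT_rapidly_decreasing[OF s] by simp
  next
    case (Suc n)
    show ?case
      by (rule derivs_inI[where f' = "FT s (\<lambda>\<xi>. \<i> * s * (of_real \<xi> * f \<xi>))"])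
         (intro FT_rapidly_decreasing[OF s] FT_has_vector_derivative Suc.IH Schwartz_cmult
            Schwartz_ident_mult Suc.prems)+
  qed
qed

text \<open>Fubini's theorem for \<open>h(x) e\<^bsup>isx\<xi>\<^esup> f(\<xi>)\<close>, whose modulus is a product of integrable functions.\<close>

lemma FT_multiplication_formula:
  assumes f: "integrable lborel f" and h: "integrable lborel h"
  shows "(\<integral>x. h x * FT s f x \<partial>lborel) = (\<integral>\<xi>. f \<xi> * FT s h \<xi> \<partial>lborel)"
proof -
  have [measurable]: "f \<in> borel_measurable borel" "h \<in> borel_measurable borel"
    using borel_measurable_integrable[OF f] borel_measurable_integrable[OF h] by auto
  have nx: "cmod (h x * (iexp (s * x * \<xi>) * f \<xi>)) = cmod (h x) * cmod (f \<xi>)" for x \<xi>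
    by (simp add: norm_mult)
  have [measurable]: "iexp \<in> borel_measurable borel"
    by (intro borel_measurable_continuous_onI continuous_intros)
  have "integrable (lborel \<Otimes>\<^sub>M lborel) (\<lambda>(x, \<xi>). h x * (iexp (s * x * \<xi>) * f \<xi>))"
  proof (rule lborel_pair.Fubini_integrable)
    show "integrable lborel (\<lambda>x. \<integral>\<xi>. cmod (case (x, \<xi>) of (x, \<xi>) \<Rightarrow> h x * (iexp (s * x * \<xi>) * f \<xi>)) \<partial>lborel)"
      by (simp only: prod.case nx) (use f h in simp)
    show "AE x in lborel. integrable lborel (\<lambda>\<xi>. case (x, \<xi>) of (x, \<xi>) \<Rightarrow> h x * (iexp (s * x * \<xi>) * f \<xi>))"
      unfolding prod.case by (intro AE_I2 integrable_mult_right integrable_iexp_mult f)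
  qed (unfold case_prod_beta, measurable)
  note Fubini = lborel_pair.Fubini_integral[OF this]
  have "(\<integral>x. h x * FT s f x \<partial>lborel)
      = (\<integral>x. (\<integral>\<xi>. h x * (iexp (s * x * \<xi>) * f \<xi>) \<partial>lborel) \<partial>lborel)"
    unfolding FT_def by simp
  also have "\<dots> = (\<integral>\<xi>. (\<integral>x. h x * (iexp (s * x * \<xi>) * f \<xi>) \<partial>lborel) \<partial>lborel)"
    using Fubini by simp
  also have "\<dots> = (\<integral>\<xi>. (\<integral>x. f \<xi> * (iexp (s * \<xi> * x) * h x) \<partial>lborel) \<partial>lborel)"
    by (intro Bochner_Integration.integral_cong refl) (simp add: mult_ac)
  finally show ?thesis
    unfolding FT_def by simp
qed

section \<open>Fourier inversion and the Plancherel identity\<close>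

abbreviation gauss :: "real \<Rightarrow> real" where "gauss \<equiv> std_normal_density"

text \<open>Up to the factor \<open>\<surd>(2\<pi>)\<close> the Gaussian is its own Fourier transform; this is the characteristic function of the standard
normal distribution.\<close>

lemma gauss_iexp_integral:
  "(\<integral>x. iexp (t * x) * of_real (gauss x) \<partial>lborel) = of_real (sqrt (2 * pi) * gauss t)"
proof -
  have [measurable]: "iexp \<in> borel_measurable borel"
    by (intro borel_measurable_continuous_onI continuous_intros)
  have "of_real (exp (- (t\<^sup>2) / 2)) = char std_normal_distribution t"
    by (simp add: char_std_normal_distribution)
  also have "\<dots> = (\<integral>x. gauss x *\<^sub>R iexp (t * x) \<partial>lborel)"
    unfolding char_def by (rule integral_density) auto
  finally show ?thesis
    by (simp add: scaleR_conv_of_real mult.commute std_normal_density_def real_sqrt_mult)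
qed

text \<open>Removal of the Gaussian regularisation on the side of the transformed function.\<close>

lemma gauss_tendsto:
  assumes F: "integrable lborel F"
  shows "(\<lambda>n. \<integral>x. of_real (gauss (x / real (Suc n))) * F x \<partial>lborel)
           \<longlonglongrightarrow> of_real (gauss 0) * (\<integral>x. F x \<partial>lborel :: complex)"
proof -
  have [measurable]: "F \<in> borel_measurable borel" using borel_measurable_integrable[OF F] by simp
  have le: "gauss x \<le> gauss 0" for x
    by (simp add: std_normal_density_def divide_right_mono)
  have "(\<lambda>n. \<integral>x. of_real (gauss (x / real (Suc n))) * F x \<partial>lborel)
      \<longlonglongrightarrow> (\<integral>x. of_real (gauss 0) * F x \<partial>lborel)"
  proof (rule integral_dominated_convergence[where w = "\<lambda>x. gauss 0 * cmod (F x)"])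
    show "AE x in lborel. (\<lambda>n. of_real (gauss (x / real (Suc n))) * F x) \<longlonglongrightarrow> of_real (gauss 0) * F x"
    proof (rule AE_I2)
      fix x :: real
      have "(\<lambda>n. x / real (Suc n)) \<longlonglongrightarrow> 0"
        by (rule LIMSEQ_Suc[OF lim_const_over_n])
      moreover have "isCont gauss 0"
        unfolding std_normal_density_def by (intro continuous_intros) auto
      ultimately have "(\<lambda>n. gauss (x / real (Suc n))) \<longlonglongrightarrow> gauss 0"
        by (rule isCont_tendsto_compose[rotated])
      then show "(\<lambda>n. of_real (gauss (x / real (Suc n))) * F x) \<longlonglongrightarrow> of_real (gauss 0) * F x"
        by (intro tendsto_intros)
    qed
    show "AE x in lborel. cmod (of_real (gauss (x / real (Suc n))) * F x) \<le> gauss 0 * cmod (F x)" for n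
      using le by (auto simp: norm_mult intro!: mult_right_mono)
  qed (use F in auto)
  then show ?thesis by simp
qed

text \<open>On the side of the original function the regularisation becomes averaging over a concentrating
normal distribution.\<close>

lemma gauss_approximate_identity:
  assumes F: "continuous_on UNIV F" and B: "\<And>x. cmod (F x) \<le> B"
  shows "(\<lambda>n. \<integral>x. of_real (gauss x) * F (\<eta> + x / real (Suc n)) \<partial>lborel) \<longlonglongrightarrow> F \<eta>"
proof -
  have [measurable]: "F \<in> borel_measurable borel" by (rule borel_measurable_continuous_onI[OF F])
  have "(\<lambda>n. \<integral>x. of_real (gauss x) * F (\<eta> + x / real (Suc n)) \<partial>lborel)
      \<longlonglongrightarrow> (\<integral>x. of_real (gauss x) * F \<eta> \<partial>lborel)"
  proof (rule integral_dominated_convergence[where w = "\<lambda>x. gauss x * B"])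
    show "AE x in lborel. (\<lambda>n. of_real (gauss x) * F (\<eta> + x / real (Suc n))) \<longlonglongrightarrow> of_real (gauss x) * F \<eta>"
    proof (rule AE_I2)
      fix x :: real
      have "(\<lambda>n. \<eta> + x / real (Suc n)) \<longlonglongrightarrow> \<eta> + 0"
        by (intro tendsto_intros LIMSEQ_Suc[OF lim_const_over_n])
      moreover have "isCont F (\<eta> + 0)"
        using F by (simp add: continuous_on_eq_continuous_at)
      ultimately have "(\<lambda>n. F (\<eta> + x / real (Suc n))) \<longlonglongrightarrow> F (\<eta> + 0)"
        by (rule isCont_tendsto_compose[rotated])
      then show "(\<lambda>n. of_real (gauss x) * F (\<eta> + x / real (Suc n))) \<longlonglongrightarrow> of_real (gauss x) * F \<eta>"
        by (intro tendsto_intros) simp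
    qed
    show "integrable lborel (\<lambda>x. gauss x * B)"
      by (intro integrable_mult_left integrable_normal_density) auto
    show "AE x in lborel. cmod (of_real (gauss x) * F (\<eta> + x / real (Suc n))) \<le> gauss x * B" for n
      using B by (auto simp: norm_mult intro!: mult_left_mono)
  qed auto
  moreover have "(\<integral>x. gauss x \<partial>lborel) = 1" by (rule integral_normal_density) auto
  ultimately show ?thesis by simp
qed

text \<open>The transform is integrated against \<open>e\<^bsup>i\<eta>x\<^esup>\<close> with a wide Gaussian cutoff of width \<open>n\<close>. By the
multiplication formula this equals the mean of \<open>f\<close> over a normal distribution of width \<open>1/n\<close> around
\<open>\<eta>\<close>, up to a constant; both sides converge as \<open>n\<close> grows. The factor \<open>2\<pi>\<close> arises as
\<open>\<surd>(2\<pi>)\<close> from the transform of the Gaussian divided by its value \<open>1/\<surd>(2\<pi>)\<close> at \<open>0\<close>.\<close>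

theorem FT_inversion:
  fixes f :: "real \<Rightarrow> complex"
  assumes f: "Schwartz f" shows "FT 1 (FT (-1) f) \<eta> = 2 * pi * f \<eta>"
proof -
  obtain B where B: "\<And>x. cmod (f x) \<le> B" using Schwartz_bounded[OF f] by blast
  define h where "h n x = iexp (\<eta> * x) * of_real (gauss (x / real (Suc n)))" for n x
  have Tf: "Schwartz (FT (-1) f)" by (rule Schwartz_FT[OF _ f]) simp
  have gi: "integrable lborel (\<lambda>x. complex_of_real (gauss (x / real (Suc n))))" for n
    using lborel_integrable_real_affine[OF integrable_normal_density[of 1 0], of "1 / real (Suc n)" 0]
    by simp
  have hi: "integrable lborel (h n)" for n
    unfolding h_def [abs_def] by (intro integrable_iexp_mult gi)
  have FTh: "FT (-1) (h n) \<xi> = of_real (real (Suc n) * sqrt (2 * pi) * gauss (real (Suc n) * (\<xi> - \<eta>)))" for n \<xi>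
  proof -
    let ?N = "real (Suc n)"
    have "FT (-1) (h n) \<xi> = (\<integral>x. iexp ((\<eta> - \<xi>) * x) * of_real (gauss (x / ?N)) \<partial>lborel)"
      unfolding FT_def h_def
      by (intro Bochner_Integration.integral_cong refl) (simp add: algebra_simps flip: exp_add)
    also have "\<dots> = ?N *\<^sub>R (\<integral>x. iexp ((\<eta> - \<xi>) * (0 + ?N * x)) * of_real (gauss ((0 + ?N * x) / ?N)) \<partial>lborel)"
      by (subst lborel_integral_real_affine[where c = ?N and t = 0]) auto
    also have "(\<integral>x. iexp ((\<eta> - \<xi>) * (0 + ?N * x)) * of_real (gauss ((0 + ?N * x) / ?N)) \<partial>lborel)
        = (\<integral>x. iexp ((?N * (\<eta> - \<xi>)) * x) * of_real (gauss x) \<partial>lborel)"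
      by (intro Bochner_Integration.integral_cong refl) (simp add: mult_ac)
    also have "\<dots> = of_real (sqrt (2 * pi) * gauss (?N * (\<eta> - \<xi>)))"
      by (rule gauss_iexp_integral)
    also have "gauss (?N * (\<eta> - \<xi>)) = gauss (?N * (\<xi> - \<eta>))"
      by (simp add: std_normal_density_def power_mult_distrib power2_commute)
    finally show ?thesis by (simp add: scaleR_conv_of_real)
  qed
  have eq: "(\<integral>x. h n x * FT (-1) f x \<partial>lborel)
      = of_real (sqrt (2 * pi)) * (\<integral>x. of_real (gauss x) * f (\<eta> + x / real (Suc n)) \<partial>lborel)" for n
  proof -
    let ?N = "real (Suc n)"
    have "(\<integral>x. h n x * FT (-1) f x \<partial>lborel) = (\<integral>\<xi>. f \<xi> * FT (-1) (h n) \<xi> \<partial>lborel)"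
      by (intro FT_multiplication_formula Schwartz_integrable f hi)
    also have "\<dots> = (1 / ?N) *\<^sub>R (\<integral>x. f (\<eta> + (1 / ?N) * x) * FT (-1) (h n) (\<eta> + (1 / ?N) * x) \<partial>lborel)"
      by (subst lborel_integral_real_affine[where c = "1 / ?N" and t = \<eta>]) auto
    also have "\<dots> = (\<integral>x. (1 / ?N) *\<^sub>R (f (\<eta> + (1 / ?N) * x) * FT (-1) (h n) (\<eta> + (1 / ?N) * x)) \<partial>lborel)"
      by simp
    also have "\<dots> = (\<integral>x. of_real (sqrt (2 * pi)) * (of_real (gauss x) * f (\<eta> + x / ?N)) \<partial>lborel)"
      by (intro Bochner_Integration.integral_cong refl)
         (simp add: FTh scaleR_conv_of_real del: of_nat_Suc)
    finally show ?thesis by simp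
  qed
  have "(\<lambda>n. \<integral>x. h n x * FT (-1) f x \<partial>lborel) \<longlonglongrightarrow> of_real (sqrt (2 * pi)) * f \<eta>"
    unfolding eq by (intro tendsto_intros gauss_approximate_identity[where B = B] Schwartz_continuous f B)
  moreover have "(\<lambda>n. \<integral>x. h n x * FT (-1) f x \<partial>lborel) \<longlonglongrightarrow> of_real (gauss 0) * FT 1 (FT (-1) f) \<eta>"
    using gauss_tendsto[OF integrable_iexp_mult[OF Schwartz_integrable[OF Tf], of \<eta>]]
    by (simp add: h_def FT_def mult_ac)
  ultimately have "of_real (gauss 0) * FT 1 (FT (-1) f) \<eta> = of_real (sqrt (2 * pi)) * f \<eta>"
    by (rule LIMSEQ_unique[rotated])
  then have "of_real (sqrt (2 * pi)) * (of_real (gauss 0) * FT 1 (FT (-1) f) \<eta>)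
      = of_real (sqrt (2 * pi) * sqrt (2 * pi)) * f \<eta>"
    by (simp only: of_real_mult mult.assoc)
  \<comment> \<open>Multiplying by \<open>sqrt (2 * pi)\<close> cancels the factor \<open>gauss 0\<close>.\<close>
  moreover have "sqrt (2 * pi) * gauss 0 = 1" by (simp add: std_normal_density_def)
  ultimately show ?thesis
    by (simp add: mult.assoc [symmetric] of_real_mult [symmetric] del: of_real_mult)
qed

text \<open>Apply the multiplication formula with the conjugate of \<open>FT (-1) f\<close> as second function: by inversion
its transform is \<open>2\<pi>\<close> times the conjugate of \<open>f\<close>.\<close>

theorem FT_Plancherel:
  fixes f :: "real \<Rightarrow> complex"
  assumes f: "Schwartz f"
  shows "(\<integral>x. (cmod (FT (-1) f x))\<^sup>2 \<partial>lborel) = 2 * pi * (\<integral>\<xi>. (cmod (f \<xi>))\<^sup>2 \<partial>lborel)"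
proof -
  have Tf: "Schwartz (FT (-1) f)" by (rule Schwartz_FT[OF _ f]) simp
  have FTcnj: "FT (-1) (\<lambda>x. cnj (FT (-1) f x)) \<xi> = 2 * pi * cnj (f \<xi>)" for \<xi>
  proof -
    have "FT (-1) (\<lambda>x. cnj (FT (-1) f x)) \<xi> = (\<integral>x. cnj (iexp (1 * \<xi> * x) * FT (-1) f x) \<partial>lborel)"
      unfolding FT_def [of "-1" "\<lambda>x. cnj (FT (-1) f x)"] by (simp add: exp_cnj)
    also have "\<dots> = cnj (FT 1 (FT (-1) f) \<xi>)" unfolding FT_def [of 1] by (rule Bochner_Integration.integral_cnj)
    finally show ?thesis by (simp add: FT_inversion[OF f])
  qed
  have "complex_of_real (\<integral>x. (cmod (FT (-1) f x))\<^sup>2 \<partial>lborel)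
      = (\<integral>x. cnj (FT (-1) f x) * FT (-1) f x \<partial>lborel)"
    unfolding integral_complex_of_real [symmetric]
    by (intro Bochner_Integration.integral_cong refl) (subst complex_norm_square, rule mult.commute)
  also have "\<dots> = (\<integral>\<xi>. f \<xi> * FT (-1) (\<lambda>x. cnj (FT (-1) f x)) \<xi> \<partial>lborel)"
    by (intro FT_multiplication_formula Schwartz_integrable f integrable_cnj Tf)
  also have "\<dots> = (\<integral>\<xi>. of_real (2 * pi * (cmod (f \<xi>))\<^sup>2) \<partial>lborel)"
    by (intro Bochner_Integration.integral_cong refl) (simp only: FTcnj complex_norm_square of_real_mult mult_ac)
  also have "\<dots> = of_real (2 * pi * (\<integral>\<xi>. (cmod (f \<xi>))\<^sup>2 \<partial>lborel))"
    by (subst integral_complex_of_real) simp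
  finally show ?thesis by (simp only: of_real_eq_iff)
qed

lemma integral_FT:
  fixes f :: "real \<Rightarrow> complex"
  assumes f: "Schwartz f" shows "(\<integral>x. FT (-1) f x \<partial>lborel) = 2 * pi * f 0"
  using FT_inversion[OF f, of 0] by (simp add: FT_def [of 1])

lemma integral_ident_FT:
  fixes f :: "real \<Rightarrow> complex"
  assumes f: "Schwartz f" shows "(\<integral>x. x * FT (-1) f x \<partial>lborel) = - (2 * pi * \<i>) * dv f 0"
proof -
  have "x * FT (-1) f x = - \<i> * FT (-1) (dv f) x" for x
    by (simp add: FT_dv[OF f] flip: mult.assoc)
  then show ?thesis
    using integral_FT[OF Schwartz_dv[OF f]] by simp
qed

section \<open>The dispersion relation\<close>

definition nonlocal_kernel :: "real \<Rightarrow> real \<Rightarrow> real \<Rightarrow> real" where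
  "nonlocal_kernel \<delta> \<alpha> y = indicator {-\<delta>..\<delta>} y / \<bar>y\<bar> powr (1 + 2 * \<alpha>)"

lemma nonlocal_kernel_nonneg: "0 \<le> nonlocal_kernel \<delta> \<alpha> y"
  by (simp add: nonlocal_kernel_def)

lemma nonlocal_kernel_measurable [measurable]: "nonlocal_kernel \<delta> \<alpha> \<in> borel_measurable borel"
  unfolding nonlocal_kernel_def [abs_def] by measurable

lemma nonlocal_kernel_eq_0: "\<bar>y\<bar> > \<delta> \<Longrightarrow> nonlocal_kernel \<delta> \<alpha> y = 0"
  by (auto simp: nonlocal_kernel_def indicator_def)

text \<open>The second moment has density \<open>|y|\<^bsup>1-2\<alpha>\<^esup>\<close> near the origin, and \<open>1 - 2\<alpha> > -1\<close>. For \<open>\<alpha> \<ge> 1/2\<close> the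
first absolute moment diverges, so integrands below are always bounded by multiples of \<open>y\<^sup>2\<close>.\<close>

lemma nonlocal_kernel_second_moment:
  assumes "\<delta> > 0" "\<alpha> < 1"
  shows "integrable lborel (\<lambda>y. y\<^sup>2 * nonlocal_kernel \<delta> \<alpha> y)"
proof -
  \<comment> \<open>The two halves of the interval are glued by reflection; both sides vanish at \<open>y = 0\<close>, as
    \<open>0 powr (1 - 2 * \<alpha>) = 0\<close> and \<open>x / 0 = 0\<close>.\<close>
  define g where "g y = indicator {0..\<delta>} y *\<^sub>R (y powr (1 - 2 * \<alpha>))" for y :: real
  have "(\<lambda>y. y powr (1 - 2 * \<alpha>)) integrable_on {0..\<delta>}"
    by (rule integrable_on_powr_from_0) (use assms in auto)
  then have "(\<lambda>y. y powr (1 - 2 * \<alpha>)) absolutely_integrable_on {0..\<delta>}"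
    by (subst absolutely_integrable_on_iff_nonneg) auto
  then have g: "integrable lborel g"
    unfolding set_integrable_def g_def [abs_def] by (subst (asm) integrable_completion) auto
  have "integrable lborel (\<lambda>y. g y + g (0 + (-1) * y))"
    by (intro Bochner_Integration.integrable_add g lborel_integrable_real_affine) auto
  also have "(\<lambda>y. g y + g (0 + (-1) * y)) = (\<lambda>y. y\<^sup>2 * nonlocal_kernel \<delta> \<alpha> y)"
  proof
    fix y :: real
    have pw: "x powr (1 - 2 * \<alpha>) = x\<^sup>2 / x powr (1 + 2 * \<alpha>)" if "x > 0" for x :: real
      using that powr_diff[of x 2 "1 + 2 * \<alpha>"] by (simp add: powr_numeral)
    show "g y + g (0 + (-1) * y) = y\<^sup>2 * nonlocal_kernel \<delta> \<alpha> y"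
      using pw[of y] pw[of "- y"] assms
      by (cases y "0::real" rule: linorder_cases)
         (auto simp: g_def nonlocal_kernel_def indicator_def)
  qed
  finally show ?thesis .
qed

text \<open>The \<open>k\<close>-th derivative of \<open>1 - cos\<close>, in closed form: each differentiation of the cosine shifts its
argument by \<open>\<pi>/2\<close>, and the constant survives for \<open>k = 0\<close> only.\<close>

definition symbol_trig :: "nat \<Rightarrow> real \<Rightarrow> real" where
  "symbol_trig k \<theta> = (if k = 0 then 1 else 0) - cos (\<theta> + k * pi / 2)"

text \<open>The \<open>k\<close>-th \<open>\<xi>\<close>-derivative of \<open>\<integral> (1 - cos(\<xi>y)) k(y) dy\<close>.\<close>

definition symbol_moment :: "real \<Rightarrow> real \<Rightarrow> nat \<Rightarrow> real \<Rightarrow> complex" where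
  "symbol_moment \<delta> \<alpha> k \<xi> =
     (\<integral>y. of_real (y ^ k * symbol_trig k (\<xi> * y) * nonlocal_kernel \<delta> \<alpha> y) \<partial>lborel)"

lemma one_minus_cos_le: "1 - cos \<theta> \<le> (\<theta>::real)\<^sup>2"
  using cos_remainder[of 0 \<theta>] by simp

lemma symbol_trig_measurable [measurable]: "symbol_trig k \<in> borel_measurable borel"
  unfolding symbol_trig_def [abs_def] by measurable

lemma symbol_trig_remainder:
  "\<bar>symbol_trig k (\<theta> + h) - symbol_trig k \<theta> - h * symbol_trig (Suc k) \<theta>\<bar> \<le> h\<^sup>2"
proof -
  have "cos (\<theta> + real (Suc k) * pi / 2) = cos ((\<theta> + real k * pi / 2) + pi / 2)"
    by (simp add: algebra_simps add_divide_distrib)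
  also have "\<dots> = - sin (\<theta> + real k * pi / 2)" by (simp add: cos_add)
  finally show ?thesis
    using cos_remainder[of "\<theta> + real k * pi / 2" h]
    by (simp add: symbol_trig_def algebra_simps abs_minus_commute)
qed

text \<open>The factor \<open>y\<^sup>2\<close> comes from the trigonometric function when \<open>k = 0\<close>, from both factors when
\<open>k = 1\<close>, and from \<open>y\<^bsup>k\<^esup>\<close> when \<open>k \<ge> 2\<close>. The first two cases cost powers of \<open>\<xi>\<close>, which is why the
square of the dispersion relation is only polynomially bounded.\<close>

lemma power_mult_symbol_trig_le:
  assumes y: "\<bar>y\<bar> \<le> \<delta>"
  shows "\<bar>y ^ k * symbol_trig k (\<xi> * y)\<bar> \<le> (1 + \<delta>) ^ k * (1 + \<bar>\<xi>\<bar>)\<^sup>2 * y\<^sup>2"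
proof -
  have \<delta>: "0 \<le> \<delta>" using y by simp
  have one: "1 \<le> (1 + \<bar>\<xi>\<bar>)\<^sup>2" and xi: "\<bar>\<xi>\<bar> \<le> (1 + \<bar>\<xi>\<bar>)\<^sup>2" and xi2: "\<xi>\<^sup>2 \<le> (1 + \<bar>\<xi>\<bar>)\<^sup>2"
    by (auto simp: power2_eq_square algebra_simps)
  consider "k = 0" | "k = 1" | m where "k = m + 2"
    by (metis One_nat_def add_2_eq_Suc' not0_implies_Suc)
  then show ?thesis
  proof cases
    case 1
    have "\<bar>1 - cos (\<xi> * y)\<bar> \<le> (\<xi> * y)\<^sup>2" using one_minus_cos_le[of "\<xi> * y"] by simp
    also have "\<dots> \<le> (1 + \<bar>\<xi>\<bar>)\<^sup>2 * y\<^sup>2"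
      unfolding power_mult_distrib by (intro mult_right_mono xi2) auto
    finally show ?thesis by (simp add: 1 symbol_trig_def)
  next
    case 2
    have "symbol_trig 1 (\<xi> * y) = sin (\<xi> * y)" by (simp add: symbol_trig_def cos_add)
    then have "\<bar>y ^ 1 * symbol_trig 1 (\<xi> * y)\<bar> = \<bar>y\<bar> * \<bar>sin (\<xi> * y)\<bar>"
      by (simp add: abs_mult)
    also have "\<dots> \<le> \<bar>y\<bar> * \<bar>\<xi> * y\<bar>"
      by (intro mult_left_mono abs_sin_x_le_abs_x) auto
    also have "\<dots> = \<bar>\<xi>\<bar> * y\<^sup>2" by (simp add: abs_mult power2_eq_square)
    also have "\<dots> \<le> ((1 + \<delta>) * (1 + \<bar>\<xi>\<bar>)\<^sup>2) * y\<^sup>2"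
    proof (rule mult_right_mono)
      have "1 * \<bar>\<xi>\<bar> \<le> (1 + \<delta>) * (1 + \<bar>\<xi>\<bar>)\<^sup>2" by (intro mult_mono xi) (use \<delta> in auto)
      then show "\<bar>\<xi>\<bar> \<le> (1 + \<delta>) * (1 + \<bar>\<xi>\<bar>)\<^sup>2" by simp
    qed auto
    finally show ?thesis by (simp add: 2)
  next
    case 3
    have "\<bar>symbol_trig k (\<xi> * y)\<bar> \<le> 1" by (simp add: symbol_trig_def 3)
    then have "\<bar>y ^ k * symbol_trig k (\<xi> * y)\<bar> \<le> \<bar>y\<bar> ^ k * 1"
      unfolding abs_mult power_abs by (intro mult_left_mono) auto
    also have "\<dots> = \<bar>y\<bar> ^ m * y\<^sup>2" by (simp add: 3 power_add power2_eq_square)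
    also have "\<dots> \<le> (1 + \<delta>) ^ k * (1 + \<bar>\<xi>\<bar>)\<^sup>2 * y\<^sup>2"
    proof (rule mult_right_mono)
      have "\<bar>y\<bar> ^ m \<le> (1 + \<delta>) ^ m" by (intro power_mono) (use y in auto)
      also have "\<dots> \<le> (1 + \<delta>) ^ k" by (intro power_increasing) (use \<delta> 3 in auto)
      finally have "\<bar>y\<bar> ^ m * 1 \<le> (1 + \<delta>) ^ k * (1 + \<bar>\<xi>\<bar>)\<^sup>2"
        by (intro mult_mono one) (use \<delta> in auto)
      then show "\<bar>y\<bar> ^ m \<le> (1 + \<delta>) ^ k * (1 + \<bar>\<xi>\<bar>)\<^sup>2" by simp
    qed auto
    finally show ?thesis .
  qed
qed

lemma symbol_moment_integrand_le:
  "\<bar>y ^ k * symbol_trig k (\<xi> * y) * nonlocal_kernel \<delta> \<alpha> y\<bar>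
     \<le> (1 + \<delta>) ^ k * (1 + \<bar>\<xi>\<bar>)\<^sup>2 * (y\<^sup>2 * nonlocal_kernel \<delta> \<alpha> y)"
proof (cases "\<bar>y\<bar> \<le> \<delta>")
  case True
  show ?thesis
    using mult_right_mono[OF power_mult_symbol_trig_le[OF True, of k \<xi>] nonlocal_kernel_nonneg[of \<delta> \<alpha> y]]
    by (simp add: abs_mult nonlocal_kernel_nonneg mult.assoc)
qed (simp add: nonlocal_kernel_eq_0)

lemma symbol_moment_integrable:
  assumes "\<delta> > 0" "\<alpha> < 1"
  shows "integrable lborel (\<lambda>y. y ^ k * symbol_trig k (\<xi> * y) * nonlocal_kernel \<delta> \<alpha> y)"
proof (rule Bochner_Integration.integrable_bound)
  show "integrable lborel (\<lambda>y. (1 + \<delta>) ^ k * (1 + \<bar>\<xi>\<bar>)\<^sup>2 * (y\<^sup>2 * nonlocal_kernel \<delta> \<alpha> y))"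
    by (intro integrable_mult_right nonlocal_kernel_second_moment assms)
  show "AE y in lborel. norm (y ^ k * symbol_trig k (\<xi> * y) * nonlocal_kernel \<delta> \<alpha> y)
      \<le> norm ((1 + \<delta>) ^ k * (1 + \<bar>\<xi>\<bar>)\<^sup>2 * (y\<^sup>2 * nonlocal_kernel \<delta> \<alpha> y))"
    unfolding real_norm_def by (intro AE_I2 order_trans[OF symbol_moment_integrand_le] abs_ge_self)
qed measurable

lemma symbol_moment_has_vector_derivative:
  assumes "\<delta> > 0" "\<alpha> < 1"
  shows "(symbol_moment \<delta> \<alpha> k has_vector_derivative symbol_moment \<delta> \<alpha> (Suc k) \<xi>) (at \<xi>)"
  unfolding symbol_moment_def [abs_def]
proof (rule has_vector_derivative_integral_quadratic)
  show "complex_integrable lborel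
      (\<lambda>y. complex_of_real (y ^ k * symbol_trig k (\<xi> * y) * nonlocal_kernel \<delta> \<alpha> y))" for k \<xi>
    by (intro integrable_of_real symbol_moment_integrable assms)
  then show "complex_integrable lborel
      (\<lambda>y. complex_of_real (y ^ Suc k * symbol_trig (Suc k) (\<xi> * y) * nonlocal_kernel \<delta> \<alpha> y))" .
  show "integrable lborel (\<lambda>y. \<delta> ^ k * (y\<^sup>2 * nonlocal_kernel \<delta> \<alpha> y))"
    by (intro integrable_mult_right nonlocal_kernel_second_moment assms)
  fix h y
  let ?R = "symbol_trig k (\<xi> * y + h * y) - symbol_trig k (\<xi> * y) - (h * y) * symbol_trig (Suc k) (\<xi> * y)"
  let ?L = "complex_of_real (y ^ k * symbol_trig k ((\<xi> + h) * y) * nonlocal_kernel \<delta> \<alpha> y) -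
          complex_of_real (y ^ k * symbol_trig k (\<xi> * y) * nonlocal_kernel \<delta> \<alpha> y) -
          h *\<^sub>R complex_of_real (y ^ Suc k * symbol_trig (Suc k) (\<xi> * y) * nonlocal_kernel \<delta> \<alpha> y)"
  have "?L = of_real (y ^ k * nonlocal_kernel \<delta> \<alpha> y * ?R)"
    by (simp add: scaleR_conv_of_real algebra_simps)
  then have eq: "cmod ?L = \<bar>y\<bar> ^ k * nonlocal_kernel \<delta> \<alpha> y * \<bar>?R\<bar>"
    by (simp only: norm_of_real abs_mult power_abs abs_of_nonneg[OF nonlocal_kernel_nonneg])
  show "cmod ?L \<le> h\<^sup>2 * (\<delta> ^ k * (y\<^sup>2 * nonlocal_kernel \<delta> \<alpha> y))"
  proof (cases "\<bar>y\<bar> \<le> \<delta>")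
    case True
    have "\<bar>y\<bar> ^ k * nonlocal_kernel \<delta> \<alpha> y * \<bar>?R\<bar> \<le> \<delta> ^ k * nonlocal_kernel \<delta> \<alpha> y * (h * y)\<^sup>2"
      by (intro mult_mono power_mono True symbol_trig_remainder)
         (use assms True in \<open>auto simp: nonlocal_kernel_nonneg\<close>)
    then show ?thesis unfolding eq by (simp add: power_mult_distrib mult_ac)
  qed (simp add: nonlocal_kernel_eq_0)
qed

lemma symbol_moment_poly_bounded:
  assumes "\<delta> > 0" "\<alpha> < 1"
  shows "poly_bounded (symbol_moment \<delta> \<alpha> k)"
proof -
  define M where "M = (\<integral>y. y\<^sup>2 * nonlocal_kernel \<delta> \<alpha> y \<partial>lborel)"
  have "cmod (symbol_moment \<delta> \<alpha> k \<xi>) \<le> ((1 + \<delta>) ^ k * M) * (1 + \<bar>\<xi>\<bar>)\<^sup>2" for \<xi>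
  proof -
    have "cmod (symbol_moment \<delta> \<alpha> k \<xi>)
        \<le> (\<integral>y. (1 + \<delta>) ^ k * (1 + \<bar>\<xi>\<bar>)\<^sup>2 * (y\<^sup>2 * nonlocal_kernel \<delta> \<alpha> y) \<partial>lborel)"
      unfolding symbol_moment_def
    proof (rule Bochner_Integration.integral_norm_bound_integral)
      show "cmod (of_real (y ^ k * symbol_trig k (\<xi> * y) * nonlocal_kernel \<delta> \<alpha> y))
          \<le> (1 + \<delta>) ^ k * (1 + \<bar>\<xi>\<bar>)\<^sup>2 * (y\<^sup>2 * nonlocal_kernel \<delta> \<alpha> y)" for y
        unfolding norm_of_real by (rule symbol_moment_integrand_le)
    qed (intro integrable_of_real integrable_mult_right symbol_moment_integrable
           nonlocal_kernel_second_moment assms)+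
    also have "\<dots> = (1 + \<delta>) ^ k * (1 + \<bar>\<xi>\<bar>)\<^sup>2 * M"
      unfolding M_def by (rule integral_mult_right_zero)
    finally show ?thesis by (simp only: mult_ac)
  qed
  then show ?thesis unfolding poly_bounded_def by blast
qed

lemma tempered_symbol_moment:
  assumes "\<delta> > 0" "\<alpha> < 1"
  shows "tempered (symbol_moment \<delta> \<alpha> k)"
  unfolding tempered_def
  using derivs_in_sequence[of poly_bounded "symbol_moment \<delta> \<alpha>"] symbol_moment_poly_bounded[OF assms]
    symbol_moment_has_vector_derivative[OF assms] by blast

definition dispersion_sq :: "real \<Rightarrow> real \<Rightarrow> real \<Rightarrow> real \<Rightarrow> real \<Rightarrow> real" where
  "dispersion_sq \<rho> \<kappa> \<delta> \<alpha> \<xi> =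
     2 * \<kappa> / \<rho> * (\<integral>y. (1 - cos (\<xi> * y)) * nonlocal_kernel \<delta> \<alpha> y \<partial>lborel)"

lemma dispersion_sq_nonneg:
  assumes "\<rho> > 0" "\<kappa> > 0" shows "0 \<le> dispersion_sq \<rho> \<kappa> \<delta> \<alpha> \<xi>"
  unfolding dispersion_sq_def using assms
  by (intro mult_nonneg_nonneg integral_nonneg_AE AE_I2) (auto simp: nonlocal_kernel_nonneg)

text \<open>The substitution \<open>y = \<delta>z\<close>; the kernel is homogeneous, which produces the factor
\<open>\<delta>\<^bsup>-2\<alpha>\<^esup>\<close>.\<close>

lemma dispersion_eq_sqrt:
  assumes \<delta>: "\<delta> > 0"
  shows "dispersion \<rho> \<kappa> \<delta> \<alpha> \<xi> = sqrt (dispersion_sq \<rho> \<kappa> \<delta> \<alpha> \<xi>)"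
proof -
  have "(\<integral>y. (1 - cos (\<xi> * y)) * nonlocal_kernel \<delta> \<alpha> y \<partial>lborel)
      = \<delta> * (\<integral>z. (1 - cos (\<xi> * (\<delta> * z))) * nonlocal_kernel \<delta> \<alpha> (\<delta> * z) \<partial>lborel)"
    using \<delta> by (subst lborel_integral_real_affine[where c = \<delta> and t = 0]) auto
  also have "\<dots> = (\<integral>z. \<delta> * ((1 - cos (\<xi> * (\<delta> * z))) * nonlocal_kernel \<delta> \<alpha> (\<delta> * z)) \<partial>lborel)"
    by simp
  also have "\<dots> = (\<integral>z. 1 / \<delta> powr (2 * \<alpha>) * (indicator {-1..1} z *\<^sub>R
      ((1 - cos (\<xi> * \<delta> * z)) / \<bar>z\<bar> powr (1 + 2 * \<alpha>))) \<partial>lborel)"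
  proof (intro Bochner_Integration.integral_cong refl)
    fix z :: real
    have ind: "indicator {-\<delta>..\<delta>} (\<delta> * z) = (indicator {-1..1} z :: real)"
      using \<delta> mult_le_cancel_left_pos[of \<delta> "-1" z] mult_le_cancel_left_pos[of \<delta> z 1]
      by (auto simp: indicator_def)
    have "\<bar>\<delta> * z\<bar> powr (1 + 2 * \<alpha>) = \<delta> * \<delta> powr (2 * \<alpha>) * \<bar>z\<bar> powr (1 + 2 * \<alpha>)"
      using \<delta> by (simp add: abs_mult powr_mult powr_add)
    then show "\<delta> * ((1 - cos (\<xi> * (\<delta> * z))) * nonlocal_kernel \<delta> \<alpha> (\<delta> * z))
        = 1 / \<delta> powr (2 * \<alpha>) * (indicator {-1..1} z *\<^sub>R
            ((1 - cos (\<xi> * \<delta> * z)) / \<bar>z\<bar> powr (1 + 2 * \<alpha>)))"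
      using \<delta> by (simp add: nonlocal_kernel_def ind mult.assoc)
  qed
  finally have "(\<integral>y. (1 - cos (\<xi> * y)) * nonlocal_kernel \<delta> \<alpha> y \<partial>lborel)
      = 1 / \<delta> powr (2 * \<alpha>) * (LBINT z:{-1..1}. (1 - cos (\<xi> * \<delta> * z)) / \<bar>z\<bar> powr (1 + 2 * \<alpha>))"
    by (simp only: set_lebesgue_integral_def integral_mult_right_zero)
  then show ?thesis
    by (simp add: dispersion_def dispersion_sq_def mult.commute)
qed

lemma dispersion_sq_symbol_moment:
  "of_real (dispersion_sq \<rho> \<kappa> \<delta> \<alpha> \<xi>) = of_real (2 * \<kappa> / \<rho>) * symbol_moment \<delta> \<alpha> 0 \<xi>"
  unfolding dispersion_sq_def symbol_moment_def
  by (subst integral_complex_of_real) (simp add: symbol_trig_def)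

lemma tempered_dispersion_sq:
  assumes "\<delta> > 0" "\<alpha> < 1"
  shows "tempered (\<lambda>\<xi>. of_real (dispersion_sq \<rho> \<kappa> \<delta> \<alpha> \<xi>))"
  unfolding dispersion_sq_symbol_moment
  by (intro tempered_mult tempered_const tempered_symbol_moment assms)

lemma dispersion_sq_0: "dispersion_sq \<rho> \<kappa> \<delta> \<alpha> 0 = 0"
  by (simp add: dispersion_sq_def)

text \<open>The derivative at \<open>0\<close> is a multiple of \<open>\<integral> y sin(0) k(y) dy\<close>. The double zero of \<open>\<omega>\<^sup>2\<close> is
what makes momentum and angular momentum independent of time.\<close>

lemma dispersion_sq_has_derivative_0:
  assumes "\<delta> > 0" "\<alpha> < 1"
  shows "((\<lambda>\<xi>. complex_of_real (dispersion_sq \<rho> \<kappa> \<delta> \<alpha> \<xi>)) has_vector_derivative 0) (at 0)"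
proof -
  have "symbol_moment \<delta> \<alpha> (Suc 0) 0 = 0"
    by (simp add: symbol_moment_def symbol_trig_def)
  then show ?thesis
    using has_vector_derivative_mult_right[OF symbol_moment_has_vector_derivative[OF assms, of 0 0], of "of_real (2 * \<kappa> / \<rho>)"]
    unfolding dispersion_sq_symbol_moment by simp
qed

text \<open>The entire function \<open>z \<mapsto> cos (\<surd>z)\<close>, given by its power series so that no branch of the
square root enters.\<close>

definition cos_sqrt :: "complex \<Rightarrow> complex" where
  "cos_sqrt z = (\<Sum>n. ((-1) ^ n / fact (2 * n)) * z ^ n)"

lemma cos_sqrt_sums:
  fixes w :: complex
  shows "(\<lambda>n. ((-1) ^ n / fact (2 * n)) * (w\<^sup>2) ^ n) sums cos w"
proof -
  have "(\<lambda>n. \<Sum>k = n * 2..<n * 2 + 2. cos_coeff k *\<^sub>R w ^ k) sums cos w"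
    by (rule sums_group[OF cos_converges]) auto
  then show ?thesis
    by (simp add: cos_coeff_def scaleR_conv_of_real power_mult [symmetric] mult.commute[of _ "2::nat"])
qed

lemma cos_sqrt_power2: "cos_sqrt (w\<^sup>2) = cos w"
  unfolding cos_sqrt_def by (rule sums_unique[symmetric, OF cos_sqrt_sums])

lemma cos_sqrt_has_field_derivative:
  "(cos_sqrt has_field_derivative (\<Sum>n. diffs (\<lambda>n. (-1) ^ n / fact (2 * n)) n * z ^ n)) (at z)"
  unfolding cos_sqrt_def [abs_def]
proof (rule termdiffs_strong_converges_everywhere)
  show "summable (\<lambda>n. (-1) ^ n / fact (2 * n) * y ^ n)" for y :: complex
    using sums_summable[OF cos_sqrt_sums[of "csqrt y"]] by simp
qed

lemma cos_sqrt_holomorphic: "cos_sqrt holomorphic_on A"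
  by (rule holomorphic_on_subset[of _ UNIV])
     (auto simp: holomorphic_on_def field_differentiable_def intro!: exI cos_sqrt_has_field_derivative
       intro: has_field_derivative_at_within)

lemma deriv_cos_sqrt_0: "deriv cos_sqrt 0 = - 1 / 2"
  using DERIV_imp_deriv[OF cos_sqrt_has_field_derivative[of 0]]
  unfolding powser_zero by (simp add: diffs_def)

text \<open>Thus \<open>sin w / w\<close> is \<open>-2\<close> times the derivative at \<open>w\<^sup>2\<close>, so a single entire function serves both
the cosine and the sine propagator.\<close>

lemma deriv_cos_sqrt_power2: "2 * w * deriv cos_sqrt (w\<^sup>2) = - sin w"
proof -
  have "(cos_sqrt has_field_derivative deriv cos_sqrt (w\<^sup>2)) (at (w\<^sup>2))"
    using holomorphic_derivI[OF cos_sqrt_holomorphic open_UNIV] by simp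
  moreover have "((\<lambda>w. w\<^sup>2) has_field_derivative 2 * w) (at w)"
    by (auto intro!: derivative_eq_intros)
  ultimately have "((\<lambda>w. cos_sqrt (w\<^sup>2)) has_field_derivative deriv cos_sqrt (w\<^sup>2) * (2 * w)) (at w)"
    by (rule DERIV_chain2)
  then have "(cos has_field_derivative deriv cos_sqrt (w\<^sup>2) * (2 * w)) (at w)"
    by (simp add: cos_sqrt_power2)
  from DERIV_unique[OF this DERIV_cos] show ?thesis by (simp add: mult_ac)
qed

text \<open>The square root maps the unit neighbourhood of the positive half-line into the strip \<open>|Im w| \<le> 2\<close>, and
there the cosine is bounded by \<open>e\<^sup>2\<close>. Indeed \<open>w\<^sup>2\<close> has real part at least \<open>-1\<close> and imaginary part at
most \<open>1\<close> in modulus, which forces \<open>|Im w|\<close> to be small.\<close>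

lemma norm_cos_sqrt_le:
  assumes x: "0 \<le> x" and z: "cmod (of_real x - z) = 1"
  shows "cmod (cos_sqrt z) \<le> exp 2"
proof -
  define w where "w = csqrt z"
  have zw: "z = w\<^sup>2" by (simp add: w_def)
  have "\<bar>Im w\<bar> \<le> 2"
  proof (rule ccontr)
    assume "\<not> \<bar>Im w\<bar> \<le> 2"
    then have "2\<^sup>2 < \<bar>Im w\<bar>\<^sup>2" by (intro power_strict_mono) auto
    then have q: "4 < (Im w)\<^sup>2" by simp
    have "\<bar>x - Re z\<bar> \<le> 1" "\<bar>Im z\<bar> \<le> 1"
      using abs_Re_le_cmod[of "of_real x - z"] abs_Im_le_cmod[of "of_real x - z"] z by auto
    moreover have "Re z = (Re w)\<^sup>2 - (Im w)\<^sup>2" "Im z = 2 * (Re w * Im w)"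
      by (simp_all add: zw power2_eq_square)
    ultimately have p: "(Re w)\<^sup>2 > 3" and i: "\<bar>2 * (Re w * Im w)\<bar> \<le> 1" using x q by auto
    have "\<bar>2 * (Re w * Im w)\<bar>\<^sup>2 \<le> 1\<^sup>2" by (rule power_mono[OF i]) auto
    then have "4 * ((Re w)\<^sup>2 * (Im w)\<^sup>2) \<le> 1" by (simp add: power_mult_distrib)
    moreover have "3 * 4 \<le> (Re w)\<^sup>2 * (Im w)\<^sup>2" by (rule mult_mono) (use p q in auto)
    ultimately show False by simp
  qed
  then have "(exp (- Im w) + exp (Im w)) / 2 \<le> (exp 2 + exp 2) / 2"
    by (intro divide_right_mono add_mono) auto
  moreover have "cmod (cos w) \<le> (exp (- Im w) + exp (Im w)) / 2"
    using norm_triangle_ineq[of "exp (\<i> * w)" "exp (- (\<i> * w))"]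
    by (simp add: cos_exp_eq norm_divide)
  ultimately have "cmod (cos w) \<le> exp 2" by simp
  then show ?thesis by (simp add: zw cos_sqrt_power2)
qed

text \<open>Cauchy's estimate on the disc of radius \<open>1\<close>. The bound does not depend on \<open>x\<close>, which is what
composition with an unbounded \<open>\<omega>\<^sup>2\<close> requires.\<close>

lemma norm_higher_deriv_cos_sqrt_le:
  assumes "0 \<le> x" shows "cmod ((deriv ^^ n) cos_sqrt (of_real x)) \<le> fact n * exp 2"
  using Cauchy_inequality[of cos_sqrt "of_real x" 1 "exp 2" n, OF cos_sqrt_holomorphic
      holomorphic_on_imp_continuous_on[OF cos_sqrt_holomorphic] _ norm_cos_sqrt_le[OF assms]]
  by simp

text \<open>Each differentiation replaces the outer function by its derivative and multiplies by the derivative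
of \<open>W\<close>. The claim is therefore proved for all derivatives of the outer function simultaneously.\<close>

lemma tempered_cos_sqrt_compose:
  assumes W: "tempered (\<lambda>\<xi>. of_real (W \<xi>))" and nonneg: "\<And>\<xi>. 0 \<le> W \<xi>"
  shows "tempered (\<lambda>\<xi>. (deriv ^^ k) cos_sqrt (of_real (W \<xi>)))"
  unfolding tempered_def
proof
  have pb: "poly_bounded (\<lambda>\<xi>. (deriv ^^ k) cos_sqrt (of_real (W \<xi>)))" for k
    by (rule bounded_imp_poly_bounded norm_higher_deriv_cos_sqrt_le nonneg)+
  have W': "((\<lambda>\<xi>. of_real (W \<xi>)) has_vector_derivative dv (\<lambda>\<xi>. of_real (W \<xi>)) \<xi>) (at \<xi>)" for \<xi>
    using W unfolding tempered_def by (blast intro: derivs_in_vector_derivative)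
  have dW: "derivs_in poly_bounded n (dv (\<lambda>\<xi>. of_real (W \<xi>)))" for n
    using W unfolding tempered_def by (metis derivs_in.simps(2))
  show "derivs_in poly_bounded n (\<lambda>\<xi>. (deriv ^^ k) cos_sqrt (of_real (W \<xi>)))" for n
  proof (induction n arbitrary: k)
    case (Suc n)
    have "((deriv ^^ k) cos_sqrt has_field_derivative (deriv ^^ Suc k) cos_sqrt z) (at z)" for z
      using holomorphic_derivI[OF holomorphic_higher_deriv[OF cos_sqrt_holomorphic open_UNIV] open_UNIV]
      by simp
    note chain = field_vector_diff_chain_at[OF W' this]
    show ?case
    proof (rule derivs_inI[where f' = "\<lambda>\<xi>. dv (\<lambda>\<xi>. of_real (W \<xi>)) \<xi> * (deriv ^^ Suc k) cos_sqrt (of_real (W \<xi>))"])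
      show "((\<lambda>\<xi>. (deriv ^^ k) cos_sqrt (of_real (W \<xi>))) has_vector_derivative
          dv (\<lambda>\<xi>. of_real (W \<xi>)) \<xi> * (deriv ^^ Suc k) cos_sqrt (of_real (W \<xi>))) (at \<xi>)" for \<xi>
        using chain[of \<xi>] by (simp only: o_def)
      show "derivs_in poly_bounded n
          (\<lambda>\<xi>. dv (\<lambda>\<xi>. of_real (W \<xi>)) \<xi> * (deriv ^^ Suc k) cos_sqrt (of_real (W \<xi>)))"
        by (rule derivs_in_mult[OF poly_bounded_mult poly_bounded_add dW Suc.IH])
    qed (rule pb)
  qed (use pb in simp)
qed

section \<open>The nonlocal interaction energy\<close>

lemma norm_one_minus_iexp_le: "cmod (1 - iexp \<theta>) \<le> \<bar>\<theta>\<bar>"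
  using iexp_approx1[of \<theta> 0] by (simp add: norm_minus_commute)

lemma norm_one_minus_iexp_power2: "(cmod (1 - iexp \<theta>))\<^sup>2 = 2 * (1 - cos \<theta>)"
proof -
  have "(cmod (1 - iexp \<theta>))\<^sup>2 = (1 - cos \<theta>)\<^sup>2 + (sin \<theta>)\<^sup>2"
    by (simp add: cmod_power2 Re_exp Im_exp)
  also have "\<dots> = 1 - 2 * cos \<theta> + ((sin \<theta>)\<^sup>2 + (cos \<theta>)\<^sup>2)"
    by (simp add: power2_eq_square algebra_simps)
  finally show ?thesis by simp
qed

lemma tempered_one_minus_iexp: "tempered (\<lambda>\<xi>. 1 - iexp (y * \<xi>))"
  using tempered_add[OF tempered_const[of 1] tempered_mult[OF tempered_const[of "-1"] tempered_iexp[of y]]]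
  by simp

lemma FT_difference:
  assumes f: "Schwartz f"
  shows "FT (-1) f x - FT (-1) f (x - y) = FT (-1) (\<lambda>\<xi>. (1 - iexp (y * \<xi>)) * f \<xi>) x"
proof -
  have "FT (-1) f x - FT (-1) f (x - y)
      = (\<integral>\<xi>. iexp (-1 * x * \<xi>) * f \<xi> - iexp (-1 * (x - y) * \<xi>) * f \<xi> \<partial>lborel)"
    unfolding FT_def
    by (intro Bochner_Integration.integral_diff [symmetric] integrable_iexp_mult Schwartz_integrable f)
  also have "\<dots> = FT (-1) (\<lambda>\<xi>. (1 - iexp (y * \<xi>)) * f \<xi>) x"
    unfolding FT_def
  proof (intro Bochner_Integration.integral_cong refl)
    fix \<xi> :: real
    have "iexp (-1 * (x - y) * \<xi>) = iexp (-1 * x * \<xi>) * iexp (y * \<xi>)"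
      by (simp add: algebra_simps flip: exp_add)
    then show "iexp (-1 * x * \<xi>) * f \<xi> - iexp (-1 * (x - y) * \<xi>) * f \<xi>
        = iexp (-1 * x * \<xi>) * ((1 - iexp (y * \<xi>)) * f \<xi>)"
      by (simp only: algebra_simps mult_1)
  qed
  finally show ?thesis .
qed

text \<open>Provides the factor \<open>y\<^sup>2\<close> that makes the squared difference integrable against the singular kernel,
for each fixed \<open>x\<close>.\<close>

lemma FT_Lipschitz:
  assumes f: "Schwartz f"
  shows "cmod (FT (-1) f x - FT (-1) f (x - y)) \<le> (\<integral>\<xi>. cmod (of_real \<xi> * f \<xi>) \<partial>lborel) * \<bar>y\<bar>"
proof -
  have g: "Schwartz (\<lambda>\<xi>. (1 - iexp (y * \<xi>)) * f \<xi>)"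
    by (rule Schwartz_mult[OF tempered_one_minus_iexp f])
  have "cmod (FT (-1) f x - FT (-1) f (x - y)) \<le> (\<integral>\<xi>. \<bar>y\<bar> * cmod (of_real \<xi> * f \<xi>) \<partial>lborel)"
    unfolding FT_difference[OF f] unfolding FT_def
  proof (rule Bochner_Integration.integral_norm_bound_integral)
    show "integrable lborel (\<lambda>\<xi>. iexp (-1 * x * \<xi>) * ((1 - iexp (y * \<xi>)) * f \<xi>))"
      by (intro integrable_iexp_mult Schwartz_integrable g)
    show "integrable lborel (\<lambda>\<xi>. \<bar>y\<bar> * cmod (of_real \<xi> * f \<xi>))"
      by (intro integrable_mult_right integrable_norm Schwartz_integrable Schwartz_ident_mult f)
    show "cmod (iexp (-1 * x * \<xi>) * ((1 - iexp (y * \<xi>)) * f \<xi>)) \<le> \<bar>y\<bar> * cmod (of_real \<xi> * f \<xi>)" for \<xi>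
    proof -
      have "cmod (iexp (-1 * x * \<xi>) * ((1 - iexp (y * \<xi>)) * f \<xi>)) = cmod (1 - iexp (y * \<xi>)) * cmod (f \<xi>)"
        by (simp only: norm_mult norm_exp_i_times mult_1)
      also have "\<dots> \<le> \<bar>y * \<xi>\<bar> * cmod (f \<xi>)"
        by (intro mult_right_mono norm_one_minus_iexp_le) auto
      finally show ?thesis by (simp add: norm_mult abs_mult mult.assoc)
    qed
  qed
  then show ?thesis by (simp add: mult.commute)
qed

text \<open>Tonelli's theorem is used twice: first to integrate over \<open>x\<close> for fixed \<open>y\<close>, where the Plancherel
identity applies to the difference \<open>u(x) - u(x - y)\<close>, and then on the Fourier side to integrate over
\<open>y\<close> for fixed \<open>\<xi>\<close>. Convergence is established on the Fourier side, where the inner integral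
is the tempered function \<open>symbol_moment\<close> at \<open>k = 0\<close>, and carried back to the physical side.\<close>

lemma
  assumes f: "Schwartz f" and \<delta>: "\<delta> > 0" and \<alpha>: "\<alpha> < 1"
  defines "u \<equiv> FT (-1) f"
  shows integrable_nonlocal_difference:
      "integrable lborel (\<lambda>y. (cmod (u x - u (x - y)))\<^sup>2 * nonlocal_kernel \<delta> \<alpha> y)"
    and integrable_nonlocal_energy:
      "integrable lborel (\<lambda>x. \<integral>y. (cmod (u x - u (x - y)))\<^sup>2 * nonlocal_kernel \<delta> \<alpha> y \<partial>lborel)"
    and integrable_nonlocal_energy_Fourier:
      "integrable lborel (\<lambda>\<xi>. (cmod (f \<xi>))\<^sup>2 * (\<integral>y. (1 - cos (\<xi> * y)) * nonlocal_kernel \<delta> \<alpha> y \<partial>lborel))"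
    and nonlocal_energy_Fourier:
      "(\<integral>x. (\<integral>y. (cmod (u x - u (x - y)))\<^sup>2 * nonlocal_kernel \<delta> \<alpha> y \<partial>lborel) \<partial>lborel)
       = 4 * pi * (\<integral>\<xi>. (cmod (f \<xi>))\<^sup>2 * (\<integral>y. (1 - cos (\<xi> * y)) * nonlocal_kernel \<delta> \<alpha> y \<partial>lborel) \<partial>lborel)"
proof -
  let ?k = "nonlocal_kernel \<delta> \<alpha>"
  define I where "I \<xi> = (\<integral>y. (1 - cos (\<xi> * y)) * ?k y \<partial>lborel)" for \<xi>
  define F where "F y x = (cmod (u x - u (x - y)))\<^sup>2 * ?k y" for x y
  define G where "G \<xi> y = (cmod (f \<xi>))\<^sup>2 * (2 * ((1 - cos (\<xi> * y)) * ?k y))" for \<xi> y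
  have u: "Schwartz u" unfolding u_def by (rule Schwartz_FT[OF _ f]) simp
  have [measurable]: "u \<in> borel_measurable borel" "f \<in> borel_measurable borel"
    using Schwartz_measurable u f by auto
  have F_nonneg: "0 \<le> F y x" and G_nonneg: "0 \<le> G \<xi> y" for x y \<xi>
    by (auto simp: F_def G_def nonlocal_kernel_nonneg)

  define L where "L = (\<integral>\<xi>. cmod (of_real \<xi> * f \<xi>) \<partial>lborel)"
  show "integrable lborel (\<lambda>y. (cmod (u x - u (x - y)))\<^sup>2 * ?k y)"
  proof (rule Bochner_Integration.integrable_bound)
    show "integrable lborel (\<lambda>y. L\<^sup>2 * (y\<^sup>2 * ?k y))"
      by (intro integrable_mult_right nonlocal_kernel_second_moment \<delta> \<alpha>)
    show "AE y in lborel. norm ((cmod (u x - u (x - y)))\<^sup>2 * ?k y) \<le> norm (L\<^sup>2 * (y\<^sup>2 * ?k y))"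
    proof (rule AE_I2)
      fix y
      have "(cmod (u x - u (x - y)))\<^sup>2 \<le> (L * \<bar>y\<bar>)\<^sup>2"
        unfolding u_def L_def by (intro power_mono FT_Lipschitz f) auto
      then have "(cmod (u x - u (x - y)))\<^sup>2 * ?k y \<le> (L * \<bar>y\<bar>)\<^sup>2 * ?k y"
        by (intro mult_right_mono nonlocal_kernel_nonneg)
      then show "norm ((cmod (u x - u (x - y)))\<^sup>2 * ?k y) \<le> norm (L\<^sup>2 * (y\<^sup>2 * ?k y))"
        by (simp add: nonlocal_kernel_nonneg power_mult_distrib mult.assoc)
    qed
  qed measurable

  have I_nonneg: "0 \<le> I \<xi>" for \<xi>
    unfolding I_def by (intro integral_nonneg_AE AE_I2) (auto simp: nonlocal_kernel_nonneg)
  have I_moment: "I \<xi> = cmod (symbol_moment \<delta> \<alpha> 0 \<xi>)" for \<xi>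
  proof -
    have "symbol_moment \<delta> \<alpha> 0 \<xi> = of_real (I \<xi>)"
      unfolding symbol_moment_def I_def by (subst integral_complex_of_real) (simp add: symbol_trig_def)
    then show ?thesis using I_nonneg by simp
  qed
  have int_fI: "integrable lborel (\<lambda>\<xi>. (cmod (f \<xi>))\<^sup>2 * I \<xi>)"
    using Schwartz_cmod_square_integrable[OF tempered_symbol_moment[OF \<delta> \<alpha>, of 0] f]
    by (simp add: I_moment mult.commute)
  then show "integrable lborel (\<lambda>\<xi>. (cmod (f \<xi>))\<^sup>2 * (\<integral>y. (1 - cos (\<xi> * y)) * ?k y \<partial>lborel))"
    by (simp add: I_def)

  have G_int: "integrable lborel (G \<xi>)" for \<xi>
    unfolding G_def [abs_def]
    using symbol_moment_integrable[OF \<delta> \<alpha>, of 0 \<xi>] by (intro integrable_mult_right) (simp add: symbol_trig_def)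
  have G_integral: "(\<integral>y. G \<xi> y \<partial>lborel) = 2 * ((cmod (f \<xi>))\<^sup>2 * I \<xi>)" for \<xi>
    by (simp add: G_def I_def)
  have G: "integrable (lborel \<Otimes>\<^sub>M lborel) (\<lambda>(\<xi>, y). G \<xi> y)"
  proof (rule lborel_pair.Fubini_integrable)
    show "(\<lambda>(\<xi>, y). G \<xi> y) \<in> borel_measurable (lborel \<Otimes>\<^sub>M lborel)"
      unfolding G_def by measurable
    show "integrable lborel (\<lambda>\<xi>. \<integral>y. norm (case (\<xi>, y) of (\<xi>, y) \<Rightarrow> G \<xi> y) \<partial>lborel)"
      unfolding prod.case real_norm_def abs_of_nonneg[OF G_nonneg] G_integral
      by (intro integrable_mult_right int_fI)
    show "AE \<xi> in lborel. integrable lborel (\<lambda>y. case (\<xi>, y) of (\<xi>, y) \<Rightarrow> G \<xi> y)"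
      using G_int by simp
  qed

  have F_x: "integrable lborel (F y)" "(\<integral>x. F y x \<partial>lborel) = 2 * pi * (\<integral>\<xi>. G \<xi> y \<partial>lborel)" for y
  proof -
    define g where "g \<xi> = (1 - iexp (y * \<xi>)) * f \<xi>" for \<xi>
    have g: "Schwartz g" unfolding g_def [abs_def] by (rule Schwartz_mult[OF tempered_one_minus_iexp f])
    have Tg: "Schwartz (FT (-1) g)" by (rule Schwartz_FT[OF _ g]) simp
    have diff: "u x - u (x - y) = FT (-1) g x" for x
      unfolding u_def g_def by (rule FT_difference[OF f])
    show "integrable lborel (F y)"
      unfolding F_def [abs_def] diff
      using Schwartz_cmod_square_integrable[OF tempered_const[of 1] Tg] by simp
    have "(\<integral>x. F y x \<partial>lborel) = (\<integral>x. (cmod (FT (-1) g x))\<^sup>2 \<partial>lborel) * ?k y"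
      unfolding F_def diff by simp
    also have "\<dots> = 2 * pi * ((\<integral>\<xi>. (cmod (g \<xi>))\<^sup>2 \<partial>lborel) * ?k y)"
      by (simp add: FT_Plancherel[OF g])
    also have "(\<integral>\<xi>. (cmod (g \<xi>))\<^sup>2 \<partial>lborel) * ?k y = (\<integral>\<xi>. (cmod (g \<xi>))\<^sup>2 * ?k y \<partial>lborel)"
      by simp
    also have "\<dots> = (\<integral>\<xi>. G \<xi> y \<partial>lborel)"
      by (intro Bochner_Integration.integral_cong refl)
         (simp only: g_def G_def norm_mult power_mult_distrib norm_one_minus_iexp_power2 mult_ac)
    finally show "(\<integral>x. F y x \<partial>lborel) = 2 * pi * (\<integral>\<xi>. G \<xi> y \<partial>lborel)" .
  qed
  have F: "integrable (lborel \<Otimes>\<^sub>M lborel) (\<lambda>(y, x). F y x)"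
  proof (rule lborel_pair.Fubini_integrable)
    show "(\<lambda>(y, x). F y x) \<in> borel_measurable (lborel \<Otimes>\<^sub>M lborel)"
      unfolding F_def by measurable
    show "integrable lborel (\<lambda>y. \<integral>x. norm (case (y, x) of (y, x) \<Rightarrow> F y x) \<partial>lborel)"
      unfolding prod.case real_norm_def abs_of_nonneg[OF F_nonneg] F_x(2)
      by (intro integrable_mult_right lborel_pair.integrable_snd G)
    show "AE y in lborel. integrable lborel (\<lambda>x. case (y, x) of (y, x) \<Rightarrow> F y x)"
      using F_x(1) by simp
  qed
  show "integrable lborel (\<lambda>x. \<integral>y. (cmod (u x - u (x - y)))\<^sup>2 * ?k y \<partial>lborel)"
    using lborel_pair.integrable_snd[OF F] by (simp add: F_def)
  have "(\<integral>x. (\<integral>y. F y x \<partial>lborel) \<partial>lborel) = (\<integral>y. (\<integral>x. F y x \<partial>lborel) \<partial>lborel)"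
    by (rule lborel_pair.Fubini_integral[OF F])
  also have "\<dots> = 2 * pi * (\<integral>y. (\<integral>\<xi>. G \<xi> y \<partial>lborel) \<partial>lborel)"
    by (simp add: F_x(2))
  also have "(\<integral>y. (\<integral>\<xi>. G \<xi> y \<partial>lborel) \<partial>lborel) = (\<integral>\<xi>. (\<integral>y. G \<xi> y \<partial>lborel) \<partial>lborel)"
    by (rule lborel_pair.Fubini_integral[OF G])
  also have "\<dots> = 2 * (\<integral>\<xi>. (cmod (f \<xi>))\<^sup>2 * I \<xi> \<partial>lborel)"
    by (simp add: G_integral)
  finally show "(\<integral>x. (\<integral>y. (cmod (u x - u (x - y)))\<^sup>2 * ?k y \<partial>lborel) \<partial>lborel)
       = 4 * pi * (\<integral>\<xi>. (cmod (f \<xi>))\<^sup>2 * (\<integral>y. (1 - cos (\<xi> * y)) * ?k y \<partial>lborel) \<partial>lborel)"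
    by (simp add: F_def I_def)
qed

section \<open>Evolution of the Fourier amplitudes\<close>

text \<open>The bounds on \<open>x\<^bsup>k\<^esup> v\<^bsup>(n)\<^esup>\<close> for all \<open>k\<close> combine to bounds with weights \<open>(1 + |x|)\<^bsup>k\<^esup>\<close> by the
binomial theorem.\<close>

lemma Schwartz_of_schwartz:
  assumes "schwartz v" shows "Schwartz (\<lambda>x. of_real (v x))"
proof -
  define F where "F n x = complex_of_real ((deriv ^^ n) v x)" for n x
  have "derivs_in rapidly_decreasing n (F 0)" for n
  proof (rule derivs_in_sequence)
    fix n
    have "\<exists>B. \<forall>x. \<bar>x\<bar> ^ j * cmod (F n x) \<le> B" for j
    proof -
      from assms have "bounded (range (\<lambda>x. x ^ j * (deriv ^^ n) v x))" by (simp add: schwartz_def)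
      then show ?thesis by (auto simp: bounded_iff F_def abs_mult power_abs)
    qed
    then obtain B where B: "\<And>j x. \<bar>x\<bar> ^ j * cmod (F n x) \<le> B j" by metis
    have "(1 + \<bar>x\<bar>) ^ k * cmod (F n x) \<le> (\<Sum>j\<le>k. real (k choose j) * B j)" for k x
    proof -
      have "(1 + \<bar>x\<bar>) ^ k * cmod (F n x) = (\<Sum>j\<le>k. real (k choose j) * (\<bar>x\<bar> ^ j * cmod (F n x)))"
        using binomial_ring[of "\<bar>x\<bar>" 1 k] by (simp add: add.commute sum_distrib_right mult.assoc)
      also have "\<dots> \<le> (\<Sum>j\<le>k. real (k choose j) * B j)"
        by (intro sum_mono mult_left_mono B) auto
      finally show ?thesis .
    qed
    then show "rapidly_decreasing (F n)" unfolding rapidly_decreasing_def by blast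
  next
    fix n and x :: real
    have "(deriv ^^ n) v differentiable (at x)"
      using assms by (simp add: schwartz_def differentiable_on_def)
    then have "((deriv ^^ n) v has_real_derivative deriv ((deriv ^^ n) v) x) (at x)"
      by (metis DERIV_imp_deriv real_differentiable_def)
    then show "(F n has_vector_derivative F (Suc n) x) (at x)"
      unfolding F_def [abs_def]
      by (intro has_vector_derivative_of_real) (simp add: has_real_derivative_iff_has_vector_derivative)
  qed
  then show ?thesis by (simp add: Schwartz_def F_def [abs_def])
qed

lemma Schwartz_fourier:
  assumes "schwartz v" shows "Schwartz (fourier v)"
proof -
  have "fourier v \<xi> = of_real (1 / (2 * pi)) * FT 1 (\<lambda>x. of_real (v x)) \<xi>" for \<xi>
    by (simp add: fourier_def FT_def mult_ac)
  then have eq: "fourier v = (\<lambda>\<xi>. of_real (1 / (2 * pi)) * FT 1 (\<lambda>x. of_real (v x)) \<xi>)"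
    by (rule ext)
  show ?thesis
    unfolding eq by (intro Schwartz_cmult Schwartz_FT Schwartz_of_schwartz assms) simp
qed

text \<open>Here \<open>a\<close> and \<open>b\<close> stand for the Fourier transforms of the initial position and the initial velocity.\<close>

locale nonlocal_wave_spectrum =
  fixes \<rho> \<kappa> \<delta> \<alpha> :: real and a b :: "real \<Rightarrow> complex"
  assumes pos: "\<rho> > 0" "\<kappa> > 0" "\<delta> > 0" and \<alpha>: "\<alpha> < 1"
    and a: "Schwartz a" and b: "Schwartz b"
begin

abbreviation W :: "real \<Rightarrow> real" where "W \<equiv> dispersion_sq \<rho> \<kappa> \<delta> \<alpha>"
abbreviation \<omega> :: "real \<Rightarrow> real" where "\<omega> \<xi> \<equiv> sqrt (W \<xi>)"

text \<open>The values are \<open>cos(\<omega>t)\<close> and \<open>- sin(\<omega>t)/(2\<omega>t)\<close>, written as functions of \<open>\<omega>\<^sup>2\<close>: in this form they are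
visibly smooth in \<open>\<xi>\<close>. The trigonometric forms are recovered in \<open>amplitude_eq\<close> and
\<open>velocity_eq\<close>.\<close>

definition cos_phase :: "real \<Rightarrow> real \<Rightarrow> complex" where "cos_phase t \<xi> = cos_sqrt (of_real (t\<^sup>2 * W \<xi>))"
definition deriv_phase :: "real \<Rightarrow> real \<Rightarrow> complex" where "deriv_phase t \<xi> = deriv cos_sqrt (of_real (t\<^sup>2 * W \<xi>))"

definition amplitude :: "real \<Rightarrow> real \<Rightarrow> complex" where
  "amplitude t \<xi> = cos_phase t \<xi> * a \<xi> + of_real (- 2 * t) * (deriv_phase t \<xi> * b \<xi>)"

definition velocity :: "real \<Rightarrow> real \<Rightarrow> complex" where
  "velocity t \<xi> = cos_phase t \<xi> * b \<xi> + of_real (W \<xi>) * (of_real (2 * t) * (deriv_phase t \<xi> * a \<xi>))"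

lemma W_nonneg: "0 \<le> W \<xi>"
  by (rule dispersion_sq_nonneg) (use pos in auto)

lemma omega_square: "(\<omega> \<xi>)\<^sup>2 = W \<xi>"
  using W_nonneg by simp

lemma tempered_W: "tempered (\<lambda>\<xi>. of_real (W \<xi>))"
  by (rule tempered_dispersion_sq) (use pos \<alpha> in auto)

lemma tempered_phase: "tempered (cos_phase t)" "tempered (deriv_phase t)"
proof -
  have "tempered (\<lambda>\<xi>. of_real (t\<^sup>2 * W \<xi>))"
    unfolding of_real_mult by (intro tempered_mult tempered_const tempered_W)
  from tempered_cos_sqrt_compose[OF this]
  have "tempered (\<lambda>\<xi>. (deriv ^^ k) cos_sqrt (of_real (t\<^sup>2 * W \<xi>)))" for k
    using W_nonneg by simp
  from this[of 0] this[of 1] show "tempered (cos_phase t)" "tempered (deriv_phase t)"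
    by (simp_all add: cos_phase_def [abs_def] deriv_phase_def [abs_def])
qed

lemma cos_phase_eq: "cos_phase t \<xi> = of_real (cos (\<omega> \<xi> * t))"
proof -
  have "t\<^sup>2 * W \<xi> = (\<omega> \<xi> * t)\<^sup>2" by (simp only: power_mult_distrib omega_square mult.commute)
  then show ?thesis
    unfolding cos_phase_def by (simp only: of_real_power cos_sqrt_power2 cos_of_real)
qed

lemma deriv_phase_eq: "2 * of_real (\<omega> \<xi> * t) * deriv_phase t \<xi> = - of_real (sin (\<omega> \<xi> * t))"
proof -
  have "t\<^sup>2 * W \<xi> = (\<omega> \<xi> * t)\<^sup>2" by (simp only: power_mult_distrib omega_square mult.commute)
  then show ?thesis
    unfolding deriv_phase_def by (simp only: of_real_power deriv_cos_sqrt_power2 sin_of_real)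
qed

lemma Schwartz_amplitude: "Schwartz (amplitude t)"
  unfolding amplitude_def [abs_def]
  by (intro Schwartz_add Schwartz_mult[OF tempered_phase(1)] Schwartz_mult[OF tempered_phase(2)] Schwartz_cmult a b)

lemma Schwartz_velocity: "Schwartz (velocity t)"
  unfolding velocity_def [abs_def]
  by (intro Schwartz_add Schwartz_mult[OF tempered_phase(1)] Schwartz_mult[OF tempered_phase(2)]
        Schwartz_mult[OF tempered_W] Schwartz_cmult a b)

text \<open>At zeros of \<open>\<omega>\<close> the sine quotient is given by the value \<open>-1/2\<close> of the derivative of \<open>cos (\<surd>z)\<close>
at \<open>0\<close>, which reproduces the convention \<open>sin(\<omega>t)/\<omega> = t\<close>.\<close>

lemma amplitude_eq:
  "amplitude t \<xi> = a \<xi> * cos (\<omega> \<xi> * t)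
     + b \<xi> * (if \<omega> \<xi> = 0 then t else sin (\<omega> \<xi> * t) / \<omega> \<xi>)"
proof (cases "\<omega> \<xi> = 0")
  case True
  then have "deriv_phase t \<xi> = - 1 / 2" by (simp add: deriv_phase_def deriv_cos_sqrt_0)
  then show ?thesis by (simp add: amplitude_def cos_phase_eq True mult.commute)
next
  case False
  have "of_real (\<omega> \<xi>) * (of_real (- 2 * t) * deriv_phase t \<xi>) = of_real (sin (\<omega> \<xi> * t))"
    using deriv_phase_eq[of \<xi> t] by (simp add: mult_ac)
  then have "of_real (- 2 * t) * deriv_phase t \<xi> = of_real (sin (\<omega> \<xi> * t) / \<omega> \<xi>)"
    using False by (simp add: field_simps)
  then have "of_real (- 2 * t) * (deriv_phase t \<xi> * b \<xi>) = of_real (sin (\<omega> \<xi> * t) / \<omega> \<xi>) * b \<xi>"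
    by (simp only: mult.assoc [symmetric])
  then show ?thesis using False by (simp add: amplitude_def cos_phase_eq mult.commute)
qed

lemma velocity_eq:
  "velocity t \<xi> = b \<xi> * cos (\<omega> \<xi> * t) - of_real (\<omega> \<xi>) * a \<xi> * sin (\<omega> \<xi> * t)"
proof -
  have W: "complex_of_real (W \<xi>) = of_real (\<omega> \<xi>) * of_real (\<omega> \<xi>)"
    using omega_square[of \<xi>] by (metis of_real_mult power2_eq_square)
  have "of_real (W \<xi>) * (of_real (2 * t) * (deriv_phase t \<xi> * a \<xi>))
      = of_real (\<omega> \<xi>) * a \<xi> * (2 * of_real (\<omega> \<xi> * t) * deriv_phase t \<xi>)"
    by (simp only: W of_real_mult of_real_numeral mult_ac)
  then show ?thesis
    unfolding velocity_def cos_phase_eq deriv_phase_eq by (simp add: mult.commute)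
qed

text \<open>The second time derivatives of \<open>cos(\<omega>t)\<close> and \<open>sin(\<omega>t)/\<omega>\<close> are bounded by \<open>\<omega>\<^sup>2\<close> and \<open>\<omega>\<close>. The latter is
replaced by \<open>1 + \<omega>\<^sup>2\<close>, which is smooth.\<close>

lemma amplitude_remainder:
  "cmod (amplitude (t + h) \<xi> - amplitude t \<xi> - h *\<^sub>R velocity t \<xi>)
     \<le> h\<^sup>2 * (W \<xi> * cmod (a \<xi>) + (1 + W \<xi>) * cmod (b \<xi>))"
proof -
  let ?w = "\<omega> \<xi>"
  define S where "S t = (if ?w = 0 then t else sin (?w * t) / ?w)" for t
  define p where "p = cos (?w * (t + h)) - cos (?w * t) + h * ?w * sin (?w * t)"
  define q where "q = S (t + h) - S t - h * cos (?w * t)"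
  have w: "0 \<le> ?w" using W_nonneg by simp
  have "amplitude (t + h) \<xi> - amplitude t \<xi> - h *\<^sub>R velocity t \<xi> = of_real p * a \<xi> + of_real q * b \<xi>"
    unfolding amplitude_eq velocity_eq S_def [symmetric] p_def q_def scaleR_conv_of_real
    by (simp only: of_real_add of_real_diff of_real_mult algebra_simps)
  then have "cmod (amplitude (t + h) \<xi> - amplitude t \<xi> - h *\<^sub>R velocity t \<xi>) \<le> \<bar>p\<bar> * cmod (a \<xi>) + \<bar>q\<bar> * cmod (b \<xi>)"
    using norm_triangle_ineq[of "of_real p * a \<xi>" "of_real q * b \<xi>"] by (simp add: norm_mult)
  also have "\<dots> \<le> (h\<^sup>2 * W \<xi>) * cmod (a \<xi>) + (h\<^sup>2 * (1 + W \<xi>)) * cmod (b \<xi>)"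
  proof (intro add_mono mult_right_mono)
    have "\<bar>p\<bar> \<le> (?w * h)\<^sup>2"
      using cos_remainder[of "?w * t" "?w * h"] by (simp add: p_def algebra_simps)
    then show "\<bar>p\<bar> \<le> h\<^sup>2 * W \<xi>"
      by (simp only: power_mult_distrib omega_square mult.commute)
    show "\<bar>q\<bar> \<le> h\<^sup>2 * (1 + W \<xi>)"
    proof (cases "?w = 0")
      case True
      then show ?thesis using W_nonneg[of \<xi>] by (simp add: q_def S_def)
    next
      case False
      with w have w0: "0 < ?w" by simp
      have "?w * q = sin (?w * t + ?w * h) - sin (?w * t) - (?w * h) * cos (?w * t)"
        using False by (simp add: q_def S_def field_simps)
      then have "\<bar>?w * q\<bar> \<le> (?w * h)\<^sup>2" using sin_remainder[of "?w * t" "?w * h"] by simp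
      then have "?w * \<bar>q\<bar> \<le> ?w * (?w * h\<^sup>2)"
        using w0 by (simp add: abs_mult power2_eq_square mult_ac)
      then have "\<bar>q\<bar> \<le> ?w * h\<^sup>2" using w0 by (simp only: mult_le_cancel_left_pos)
      also have "?w \<le> 1 + ?w\<^sup>2" 
        using sum_squares_bound[of ?w 1] w by (simp add: power2_eq_square)
      then have "?w * h\<^sup>2 \<le> (1 + W \<xi>) * h\<^sup>2"
        unfolding omega_square by (intro mult_right_mono) auto
      finally show ?thesis by (simp only: mult.commute)
    qed
  qed auto
  finally show ?thesis by (simp add: algebra_simps)
qed

lemma amplitude_FT_has_time_derivative:
  "((\<lambda>s. FT (-1) (amplitude s) x) has_vector_derivative FT (-1) (velocity t) x) (at t)"
  unfolding FT_def
proof (rule has_vector_derivative_integral_quadratic)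
  show "integrable lborel (\<lambda>\<xi>. iexp (-1 * x * \<xi>) * amplitude s \<xi>)" for s
    by (intro integrable_iexp_mult Schwartz_integrable Schwartz_amplitude)
  show "integrable lborel (\<lambda>\<xi>. iexp (-1 * x * \<xi>) * velocity t \<xi>)"
    by (intro integrable_iexp_mult Schwartz_integrable Schwartz_velocity)
  have "integrable lborel (\<lambda>\<xi>. cmod (of_real (W \<xi>) * a \<xi>) + (cmod (b \<xi>) + cmod (of_real (W \<xi>) * b \<xi>)))"
    by (intro Bochner_Integration.integrable_add integrable_norm Schwartz_integrable Schwartz_mult[OF tempered_W] a b)
  then show "integrable lborel (\<lambda>\<xi>. W \<xi> * cmod (a \<xi>) + (1 + W \<xi>) * cmod (b \<xi>))"
    by (simp add: norm_mult W_nonneg algebra_simps)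
  fix h \<xi>
  have "iexp (-1 * x * \<xi>) * amplitude (t + h) \<xi> - iexp (-1 * x * \<xi>) * amplitude t \<xi>
      - h *\<^sub>R (iexp (-1 * x * \<xi>) * velocity t \<xi>)
      = iexp (-1 * x * \<xi>) * (amplitude (t + h) \<xi> - amplitude t \<xi> - h *\<^sub>R velocity t \<xi>)"
    by (simp add: algebra_simps)
  then show "cmod (iexp (-1 * x * \<xi>) * amplitude (t + h) \<xi> - iexp (-1 * x * \<xi>) * amplitude t \<xi>
      - h *\<^sub>R (iexp (-1 * x * \<xi>) * velocity t \<xi>))
      \<le> h\<^sup>2 * (W \<xi> * cmod (a \<xi>) + (1 + W \<xi>) * cmod (b \<xi>))"
    using amplitude_remainder[of t h \<xi>] by (simp only: norm_mult norm_exp_i_times mult_1)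
qed

lemma cos_phase_at_0: "cos_phase t 0 = 1" "(cos_phase t has_vector_derivative 0) (at 0)"
proof -
  show "cos_phase t 0 = 1" by (simp add: cos_phase_eq dispersion_sq_0)
  have W0: "((\<lambda>\<xi>. complex_of_real (t\<^sup>2 * W \<xi>)) has_vector_derivative of_real (t\<^sup>2) * 0) (at 0)"
    unfolding of_real_mult
    by (intro has_vector_derivative_mult_right dispersion_sq_has_derivative_0) (use pos \<alpha> in auto)
  have "(cos_sqrt has_field_derivative deriv cos_sqrt z) (at z)" for z
    using holomorphic_derivI[OF cos_sqrt_holomorphic open_UNIV] by simp
  from field_vector_diff_chain_at[OF W0 this]
  show "(cos_phase t has_vector_derivative 0) (at 0)"
    by (simp add: cos_phase_def [abs_def] o_def)
qed

lemma velocity_0: "velocity t 0 = b 0"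
  by (simp add: velocity_def dispersion_sq_0 cos_phase_at_0)

lemma dv_velocity_0: "dv (velocity t) 0 = dv b 0"
proof (rule vector_derivative_at)
  have r: "Schwartz (\<lambda>\<xi>. of_real (2 * t) * (deriv_phase t \<xi> * a \<xi>))"
    by (intro Schwartz_cmult Schwartz_mult[OF tempered_phase(2)] a)
  have W0: "((\<lambda>\<xi>. complex_of_real (W \<xi>)) has_vector_derivative 0) (at 0)"
    by (rule dispersion_sq_has_derivative_0) (use pos \<alpha> in auto)
  show "(velocity t has_vector_derivative dv b 0) (at 0)"
    using has_vector_derivative_add[OF
        has_vector_derivative_mult[OF cos_phase_at_0(2)[of t] Schwartz_has_dv[OF b, of 0]]
        has_vector_derivative_mult[OF W0 Schwartz_has_dv[OF r, of 0]]]
    by (simp add: velocity_def [abs_def] cos_phase_at_0(1) dispersion_sq_0)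
qed

text \<open>With \<open>A = \<omega> a\<close> the pair (velocity, \<open>\<omega>\<close> amplitude) is obtained from \<open>(b, A)\<close> by a
rotation through the angle \<open>\<omega>t\<close>.\<close>

lemma energy_balance:
  "(cmod (velocity t \<xi>))\<^sup>2 + W \<xi> * (cmod (amplitude t \<xi>))\<^sup>2 = (cmod (b \<xi>))\<^sup>2 + W \<xi> * (cmod (a \<xi>))\<^sup>2"
proof -
  let ?w = "\<omega> \<xi>"
  define A c s where "A = of_real ?w * a \<xi>" and "c = cos (?w * t)" and "s = sin (?w * t)"
  have rotation: "(cmod (B * of_real c - A * of_real s))\<^sup>2 + (cmod (A * of_real c + B * of_real s))\<^sup>2
      = (cmod B)\<^sup>2 + (cmod A)\<^sup>2" for B
  proof -
    have "(cmod (B * of_real c - A * of_real s))\<^sup>2 + (cmod (A * of_real c + B * of_real s))\<^sup>2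
        = ((cmod B)\<^sup>2 + (cmod A)\<^sup>2) * (s\<^sup>2 + c\<^sup>2)"
      unfolding cmod_power2 by (simp add: power2_eq_square algebra_simps)
    then show ?thesis by (simp add: s_def c_def)
  qed
  have "velocity t \<xi> = b \<xi> * of_real c - A * of_real s"
    by (simp add: velocity_eq A_def c_def s_def)
  moreover have "of_real ?w * amplitude t \<xi> = A * of_real c + b \<xi> * of_real s"
    by (simp add: amplitude_eq A_def c_def s_def algebra_simps)
  then have "W \<xi> * (cmod (amplitude t \<xi>))\<^sup>2 = (cmod (A * of_real c + b \<xi> * of_real s))\<^sup>2"
    by (metis norm_mult norm_of_real power_mult_distrib power2_abs omega_square)
  moreover have "(cmod A)\<^sup>2 = W \<xi> * (cmod (a \<xi>))\<^sup>2"
    by (simp add: A_def norm_mult power_mult_distrib W_nonneg)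
  ultimately show ?thesis using rotation[of "b \<xi>"] by simp
qed

end

section \<open>Conservation laws\<close>

theorem theorem4p2:
  fixes \<rho> \<kappa> \<delta> \<alpha> :: real
    and v0 v1 :: "real \<Rightarrow> real"
    and u :: "real \<Rightarrow> real \<Rightarrow> complex"
  assumes "\<rho> > 0" "\<kappa> > 0" "\<delta> > 0" "0 < \<alpha>" "\<alpha> < 1"
    and "schwartz v0" "schwartz v1"
    and "u = nonlocal_wave \<rho> \<kappa> \<delta> \<alpha> v0 v1"
  shows "\<forall>t\<ge>0. quantities_well_defined \<delta> \<alpha> u t \<and>
           energy \<rho> \<kappa> \<delta> \<alpha> u t = energy \<rho> \<kappa> \<delta> \<alpha> u 0 \<and>
           momentum \<rho> u t = momentum \<rho> u 0 \<and>
           angular_momentum \<rho> u t = angular_momentum \<rho> u 0"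
proof -
  interpret nonlocal_wave_spectrum \<rho> \<kappa> \<delta> \<alpha> "fourier v0" "fourier v1"
    by unfold_locales (use assms in \<open>auto intro: Schwartz_fourier\<close>)
  let ?k = "nonlocal_kernel \<delta> \<alpha>"
  have u: "u t = FT (-1) (amplitude t)" for t
    unfolding assms(8) nonlocal_wave_def FT_def Let_def amplitude_eq
      dispersion_eq_sqrt[OF assms(3)]
    by (rule ext, intro Bochner_Integration.integral_cong refl) (simp add: mult_ac)
  have time_derivative: "((\<lambda>s. u s x) has_vector_derivative FT (-1) (velocity t) x) (at t)" for t x
    unfolding u by (rule amplitude_FT_has_time_derivative)
  have ut: "time_deriv u t = FT (-1) (velocity t)" for t
    unfolding time_deriv_def by (rule ext, rule vector_derivative_at, rule time_derivative)
  have Sut: "Schwartz (FT (-1) (velocity t))" for t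
    by (rule Schwartz_FT[OF _ Schwartz_velocity]) simp
  have density: "indicator {-\<delta>..\<delta>} y *\<^sub>R energy_density \<alpha> u t x y
      = (cmod (FT (-1) (amplitude t) x - FT (-1) (amplitude t) (x - y)))\<^sup>2 * ?k y" for t x y
    by (simp add: energy_density_def nonlocal_kernel_def u)
  have wd: "quantities_well_defined \<delta> \<alpha> u t" for t
    unfolding quantities_well_defined_def
  proof (intro conjI allI)
    show "(\<lambda>s. u s x) differentiable (at t)" for x
      by (rule differentiableI_vector[OF time_derivative])
    show "integrable lborel (\<lambda>x. (cmod (time_deriv u t x))\<^sup>2)"
      unfolding ut using Schwartz_cmod_square_integrable[OF tempered_const[of 1] Sut] by simp
    show "set_integrable lborel {-\<delta>..\<delta>} (energy_density \<alpha> u t x)" for x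
      unfolding set_integrable_def density
      by (intro integrable_nonlocal_difference Schwartz_amplitude assms)
    show "integrable lborel (\<lambda>x. LBINT y:{-\<delta>..\<delta>}. energy_density \<alpha> u t x y)"
      unfolding set_lebesgue_integral_def density
      by (intro integrable_nonlocal_energy Schwartz_amplitude assms)
    show "integrable lborel (time_deriv u t)"
      unfolding ut by (rule Schwartz_integrable[OF Sut])
    show "integrable lborel (\<lambda>x. x * time_deriv u t x)"
      unfolding ut by (rule Schwartz_integrable[OF Schwartz_ident_mult[OF Sut]])
  qed
  have energy: "energy \<rho> \<kappa> \<delta> \<alpha> u t
      = pi * \<rho> * (\<integral>\<xi>. (cmod (fourier v1 \<xi>))\<^sup>2 + W \<xi> * (cmod (fourier v0 \<xi>))\<^sup>2 \<partial>lborel)" for t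
  proof -
    define I where "I \<xi> = (\<integral>y. (1 - cos (\<xi> * y)) * ?k y \<partial>lborel)" for \<xi>
    have WI: "W \<xi> = 2 * \<kappa> / \<rho> * I \<xi>" for \<xi> by (simp add: dispersion_sq_def I_def)
    have int_v: "integrable lborel (\<lambda>\<xi>. (cmod (velocity t \<xi>))\<^sup>2)"
      using Schwartz_cmod_square_integrable[OF tempered_const[of 1] Schwartz_velocity] by simp
    have int_a: "integrable lborel (\<lambda>\<xi>. W \<xi> * (cmod (amplitude t \<xi>))\<^sup>2)"
      using Schwartz_cmod_square_integrable[OF tempered_W Schwartz_amplitude] by (simp add: W_nonneg)
    have "energy \<rho> \<kappa> \<delta> \<alpha> u t = \<rho> / 2 * (2 * pi * (\<integral>\<xi>. (cmod (velocity t \<xi>))\<^sup>2 \<partial>lborel))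
        + \<kappa> / 2 * (4 * pi * (\<integral>\<xi>. (cmod (amplitude t \<xi>))\<^sup>2 * I \<xi> \<partial>lborel))"
      unfolding energy_def ut FT_Plancherel[OF Schwartz_velocity] set_lebesgue_integral_def density
        nonlocal_energy_Fourier[OF Schwartz_amplitude assms(3,5)] I_def ..
    also have "\<kappa> / 2 * (4 * pi * (\<integral>\<xi>. (cmod (amplitude t \<xi>))\<^sup>2 * I \<xi> \<partial>lborel))
        = pi * \<rho> * (2 * \<kappa> / \<rho> * (\<integral>\<xi>. (cmod (amplitude t \<xi>))\<^sup>2 * I \<xi> \<partial>lborel))"
      using assms(1) by simp
    also have "2 * \<kappa> / \<rho> * (\<integral>\<xi>. (cmod (amplitude t \<xi>))\<^sup>2 * I \<xi> \<partial>lborel)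
        = (\<integral>\<xi>. 2 * \<kappa> / \<rho> * ((cmod (amplitude t \<xi>))\<^sup>2 * I \<xi>) \<partial>lborel)"
      by (rule integral_mult_right_zero [symmetric])
    also have "\<dots> = (\<integral>\<xi>. W \<xi> * (cmod (amplitude t \<xi>))\<^sup>2 \<partial>lborel)"
      unfolding WI by (simp only: mult_ac)
    also have "\<rho> / 2 * (2 * pi * (\<integral>\<xi>. (cmod (velocity t \<xi>))\<^sup>2 \<partial>lborel))
        + pi * \<rho> * (\<integral>\<xi>. W \<xi> * (cmod (amplitude t \<xi>))\<^sup>2 \<partial>lborel)
        = pi * \<rho> * (\<integral>\<xi>. (cmod (velocity t \<xi>))\<^sup>2 + W \<xi> * (cmod (amplitude t \<xi>))\<^sup>2 \<partial>lborel)"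
      by (simp add: Bochner_Integration.integral_add[OF int_v int_a] algebra_simps)
    finally show ?thesis unfolding energy_balance .
  qed
  have momentum: "momentum \<rho> u t = \<rho> * (2 * pi * fourier v1 0)" for t
    unfolding momentum_def ut integral_FT[OF Schwartz_velocity] velocity_0 ..
  have angular: "angular_momentum \<rho> u t = \<rho> * (- (2 * pi * \<i>) * dv (fourier v1) 0)" for t
    unfolding angular_momentum_def ut integral_ident_FT[OF Schwartz_velocity] dv_velocity_0 ..
  show ?thesis
    using wd by (simp only: energy momentum angular) simp
qed

end
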